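(* Suppose that $\mathcal{E}=\emptyset$ and that there is $\alpha$ with $\alpha_a=\alpha$ for all $a\in\mathcal{A}$. Then the mixed-integer exponential cone optimization problem SSD(C/TR)-ECP stated in the context is solvable in polynomial time.
   Context: The exponential cone is $$\mathcal{K}_{\exp}=\{(x,y,z)\in\mathbb{R}^3: x\ge y e^{z/y},\ y>0\}\cup\{(x,0,z)\in\mathbb{R}^3: z\le 0\le x\}.$$ Data of SSD(C/TR)-ECP: a finite set $\mathcal{A}$ of demand points; a finite set $\mathcal{R}$ of regimes; arrival rates $\Lambda_r\ge0$ with $\sum_r\Lambda_r>0$ and weights $\pi_r=\Lambda_r/\sum_{r'}\Lambda_{r'}$; costs $c\in\mathbb{R}_+^{\mathcal{R}}$; $\kappa\ge 0$; $\varepsilon>0$; access times $t_a\ge0$, thresholds $t_a^\star\ge t_a$ and tolerances $\alpha_a\in[0,1]$ for $a\in\mathcal{A}$; $\beta\in(0,1]$; $\gamma\in[0,1)$ with $\lfloor(1-\gamma)|\mathcal{A}|\rfloor\ge1$; $\Gamma\ge0$; and a conflict graph $G=(\mathcal{A},\mathcal{E})$ (undirected, edges $\{a,a'\}$). SSD(C/TR)-ECP is the problem $$\min\ \sum_{r\in\mathcal{R}}c_r\mu_r-\kappa\sum_{r\in\mathcal{R}}\nu_r$$ subject to - $\mu_r-\Lambda_r\ge\varepsilon$ for all $r\in\mathcal{R}$; - $\sum_{r\in\mathcal{R}}\pi_r\zeta_{ar}\le 1+(\alpha_a-1)s_a$ for all $a\in\mathcal{A}$; - $u_{ar}=-(\mu_r-\Lambda_r)(t_a^\star-t_a)$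 and $(\zeta_{ar},s_a,u_{ar})\in\mathcal{K}_{\exp}$ for all $a\in\mathcal{A}$, $r\in\mathcal{R}$; - $\sum_{a\in\mathcal{A}}s_a\ge\lceil\beta|\mathcal{A}|\rceil$; - $s_a+s_{a'}\le1$ for all $\{a,a'\}\in\mathcal{E}$; - $r_a\ge t_a+\sum_{r\in\mathcal{R}}\pi_r\tau_r$ and $U_a\ge r_a-\eta$ for all $a\in\mathcal{A}$; - $\eta+\frac{1}{\lfloor(1-\gamma)|\mathcal{A}|\rfloor}\sum_{a\in\mathcal{A}}U_a\le\Gamma$; - $\nu_r+\ell_r\ge0$, $(\tau_r,1,\ell_r)\in\mathcal{K}_{\exp}$ and $(\mu_r-\Lambda_r,1,\nu_r)\in\mathcal{K}_{\exp}$ for all $r\in\mathcal{R}$; - $\mu_r,\nu_r,\ell_r,\tau_r\ge0$ for all $r\in\mathcal{R}$; $U_a,r_a\ge0$ for all $a\in\mathcal{A}$; $\eta\ge0$; $s_a\in\{0,1\}$ for all $a\in\mathcal{A}$. (Here $r_a$ denotes a real variable indexed by $a\in\mathcal{A}$, not a regime.) Convention on complexity: continuous convex exponential cone programs (problems with a linear objective, linear constraints and constraints of membership in $\mathcal{K}_{\exp}$, with no integer variables) are regarded as solvable in polynomial time (by interior-point methods, in the usual sense of convex optimization); "solvable in polynomial time" is understood under this convention. *)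

theory Defs
  imports Complex_Main "HOL-Computational_Algebra.Polynomial"
begin

section \<open>Outcomes of minimisation problems\<close>

text \<open>
  Solving ``minimise \<open>f\<close> over \<open>F\<close>'' means reporting one of the following outcomes correctly.
  \<open>Unattained v\<close> reports a finite infimum \<open>v\<close> that no point of \<open>F\<close> attains; this does occur for
  exponential cone programs.
\<close>

datatype 'x outcome = Infeasible | Unbounded | Unattained real | Optimal 'x

fun correct_outcome :: "'x set \<Rightarrow> ('x \<Rightarrow> real) \<Rightarrow> 'x outcome \<Rightarrow> bool" where
  "correct_outcome F f Infeasible \<longleftrightarrow> F = {}"
| "correct_outcome F f Unbounded \<longleftrightarrow> (\<forall>b. \<exists>x\<in>F. f x < b)"
| "correct_outcome F f (Unattained v) \<longleftrightarrow> (\<forall>x\<in>F. v < f x) \<and> (\<forall>b>v. \<exists>x\<in>F. f x < b)"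
| "correct_outcome F f (Optimal x) \<longleftrightarrow> x \<in> F \<and> (\<forall>y\<in>F. f x \<le> f y)"

lemma ex_correct_outcome: "\<exists>r. correct_outcome F f r"
proof (cases "F = {} \<or> (\<forall>b. \<exists>x\<in>F. f x < b)")
  case True
  then show ?thesis
    by (metis correct_outcome.simps(1,2))
next
  case False
  then obtain b where b: "\<And>x. x \<in> F \<Longrightarrow> b \<le> f x" and ne: "F \<noteq> {}"
    by (meson not_less)
  have bdd: "bdd_below (f ` F)"
    using b by (auto simp: bdd_below_def)
  define v where "v = Inf (f ` F)"
  have lower: "v \<le> f x" if "x \<in> F" for x
    unfolding v_def using that bdd by (intro cInf_lower) auto
  have approx: "\<exists>x\<in>F. f x < c" if "v < c" for c
    using cInf_lessD[of "f ` F" c] that ne unfolding v_def by auto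
  show ?thesis
  proof (cases "\<exists>x\<in>F. f x = v")
    case True
    then obtain x where "x \<in> F" "f x = v" by blast
    then have "correct_outcome F f (Optimal x)" using lower by simp
    then show ?thesis ..
  next
    case False
    then have "correct_outcome F f (Unattained v)"
      using lower approx by (auto simp: less_le)
    then show ?thesis ..
  qed
qed


section \<open>Data with real atoms\<close>

text \<open>
  Optimal solutions of exponential cone programs are in general irrational, so algorithms work in
  the real-number model (exact real arithmetic and comparisons at unit cost). Data are binary trees
  with real atoms; lists are right-nested \<open>Cell\<close>s ending in \<open>Leaf\<close>. The number of nodes is the
  length of an input.
\<close>

datatype val = Num real | Leaf | Cell val val

primrec val_size :: "val \<Rightarrow> nat" where
  "val_size (Num x) = 1"
| "val_size Leaf = 1"
| "val_size (Cell v w) = 1 + val_size v + val_size w"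

primrec enc_list :: "val list \<Rightarrow> val" where
  "enc_list [] = Leaf"
| "enc_list (v # vs) = Cell v (enc_list vs)"

definition enc_vec :: "nat \<Rightarrow> (nat \<Rightarrow> real) \<Rightarrow> val" where
  "enc_vec n f = enc_list (map (\<lambda>i. Num (f i)) [0..<n])"

definition enc_mat :: "nat \<Rightarrow> nat \<Rightarrow> (nat \<Rightarrow> nat \<Rightarrow> real) \<Rightarrow> val" where
  "enc_mat m n f = enc_list (map (\<lambda>i. enc_vec n (f i)) [0..<m])"

fun enc_outcome :: "('x \<Rightarrow> val) \<Rightarrow> 'x outcome \<Rightarrow> val" where
  "enc_outcome enc Infeasible = enc_list [Num 0]"
| "enc_outcome enc Unbounded = enc_list [Num 1]"
| "enc_outcome enc (Unattained v) = enc_list [Num 2, Num v]"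
| "enc_outcome enc (Optimal x) = enc_list [Num 3, enc x]"


section \<open>Continuous exponential cone programs\<close>

definition K_exp :: "(real \<times> real \<times> real) set" where
  "K_exp = {(x, y, z). x \<ge> y * exp (z / y) \<and> y > 0} \<union> {(x, y, z). y = 0 \<and> z \<le> 0 \<and> 0 \<le> x}"

text \<open>
  Affine forms are sparse: \<open>(ps, b)\<close> stands for \<open>b\<close> plus the sum of \<open>a * x\<^sub>j\<close> over the pairs
  \<open>(j, a)\<close> in \<open>ps\<close>.
\<close>

type_synonym affine_form = "(nat \<times> real) list \<times> real"

definition affine_val :: "affine_form \<Rightarrow> real list \<Rightarrow> real" where
  "affine_val g x = snd g + (\<Sum>(j, a)\<leftarrow>fst g. a * x ! j)"

text \<open>
  The (dense) objective vector fixes the number of variables, so that the number of variables is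
  at most the length of the encoded program.
\<close>

record ecp =
  ecp_obj :: "real list"
  ecp_eqs :: "affine_form list"
  ecp_ineqs :: "affine_form list"
  ecp_cones :: "(affine_form \<times> affine_form \<times> affine_form) list"

definition wf_affine :: "nat \<Rightarrow> affine_form \<Rightarrow> bool" where
  "wf_affine n g \<longleftrightarrow> (\<forall>(j, a)\<in>set (fst g). j < n)"

definition wf_ecp :: "ecp \<Rightarrow> bool" where
  "wf_ecp P \<longleftrightarrow> (let n = length (ecp_obj P) in
     (\<forall>g\<in>set (ecp_eqs P). wf_affine n g) \<and>
     (\<forall>g\<in>set (ecp_ineqs P). wf_affine n g) \<and>
     (\<forall>(g, h, k)\<in>set (ecp_cones P). wf_affine n g \<and> wf_affine n h \<and> wf_affine n k))"

definition ecp_feasible :: "ecp \<Rightarrow> real list set" where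
  "ecp_feasible P = {x. length x = length (ecp_obj P) \<and>
     (\<forall>g\<in>set (ecp_eqs P). affine_val g x = 0) \<and>
     (\<forall>g\<in>set (ecp_ineqs P). affine_val g x \<ge> 0) \<and>
     (\<forall>(g, h, k)\<in>set (ecp_cones P). (affine_val g x, affine_val h x, affine_val k x) \<in> K_exp)}"

definition ecp_objective :: "ecp \<Rightarrow> real list \<Rightarrow> real" where
  "ecp_objective P x = (\<Sum>j<length (ecp_obj P). ecp_obj P ! j * x ! j)"

definition enc_reals :: "real list \<Rightarrow> val" where
  "enc_reals xs = enc_list (map Num xs)"

definition enc_affine :: "affine_form \<Rightarrow> val" where
  "enc_affine g =
     Cell (enc_list (map (\<lambda>(j, a). Cell (Num (real j)) (Num a)) (fst g))) (Num (snd g))"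

definition enc_ecp :: "ecp \<Rightarrow> val" where
  "enc_ecp P = enc_list
     [enc_reals (ecp_obj P),
      enc_list (map enc_affine (ecp_eqs P)),
      enc_list (map enc_affine (ecp_ineqs P)),
      enc_list (map (\<lambda>(g, h, k). enc_list [enc_affine g, enc_affine h, enc_affine k])
                    (ecp_cones P))]"

definition ecp_answers :: "ecp \<Rightarrow> val set" where
  "ecp_answers P =
     enc_outcome enc_reals ` {r. correct_outcome (ecp_feasible P) (ecp_objective P) r}"

text \<open>
  \<open>S\<close> maps encoded programs to encoded outcomes and \<open>T\<close> is its running time; the convention that
  exponential cone programs are solvable in polynomial time supplies such a pair.
\<close>

definition ecp_solver :: "(val \<Rightarrow> val) \<Rightarrow> (val \<Rightarrow> nat) \<Rightarrow> bool" where
  "ecp_solver S T \<longleftrightarrow>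
     (\<forall>P. wf_ecp P \<longrightarrow> S (enc_ecp P) \<in> ecp_answers P) \<and>
     (\<exists>q :: nat poly. \<forall>P. wf_ecp P \<longrightarrow> T (enc_ecp P) \<le> poly q (val_size (enc_ecp P)))"

lemma enc_list_inject: "enc_list vs = enc_list ws \<longleftrightarrow> vs = ws"
proof (induction vs arbitrary: ws)
  case Nil
  show ?case by (cases ws) auto
next
  case (Cons v vs)
  then show ?case by (cases ws) auto
qed

lemma map_inject: "inj f \<Longrightarrow> map f xs = map f ys \<longleftrightarrow> xs = ys"
  using inj_mapI[of f] by (auto dest: injD)

lemma inj_enc_affine: "inj enc_affine"
proof (rule injI)
  fix g h assume eq: "enc_affine g = enc_affine h"
  have "inj (\<lambda>(j, a). Cell (Num (real j)) (Num a))"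
    by (auto simp: inj_def)
  from map_inject[OF this] show "g = h"
    using eq by (simp add: enc_affine_def enc_list_inject prod_eq_iff)
qed

lemma inj_enc_ecp: "inj enc_ecp"
proof (rule injI)
  fix P Q assume eq: "enc_ecp P = enc_ecp Q"
  have 1: "inj Num" by (auto simp: inj_def)
  have 2: "inj (\<lambda>(g, h, k). enc_list [enc_affine g, enc_affine h, enc_affine k])"
    using inj_enc_affine by (auto simp: inj_def)
  show "P = Q"
    using eq unfolding enc_ecp_def enc_reals_def enc_list_inject list.inject
      map_inject[OF 1] map_inject[OF 2] map_inject[OF inj_enc_affine]
    by simp
qed

lemma ex_ecp_solver: "\<exists>S T. ecp_solver S T"
proof -
  define S where "S v = (SOME w. w \<in> ecp_answers (inv enc_ecp v))" for v
  have "S (enc_ecp P) \<in> ecp_answers P" for P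
  proof -
    have "\<exists>w. w \<in> ecp_answers P"
      using ex_correct_outcome[of "ecp_feasible P" "ecp_objective P"]
      unfolding ecp_answers_def by blast
    then show ?thesis
      unfolding S_def inv_f_f[OF inj_enc_ecp] by (rule someI_ex)
  qed
  then have "ecp_solver S (\<lambda>_. 0)"
    by (auto simp: ecp_solver_def)
  then show ?thesis by blast
qed


section \<open>Programs calling a solver for exponential cone programs\<close>

text \<open>
  A while language on real-atom trees. Expressions are total: heads and tails of non-cells are
  \<open>Leaf\<close>, and non-numbers count as \<open>0\<close> in arithmetic. Literals are integers, so that a program
  cannot hide information in real constants.
\<close>

datatype expr =
    Var nat | Lit int | Empty | Pair expr expr | Hd expr | Tl expr
  | Add expr expr | Sub expr expr | Mul expr expr | Div expr expr

datatype test = IsCell expr | Leq expr expr | Neg test | Conj test test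

datatype com =
    Skip
  | Assign nat expr
  | Solve nat expr
  | Seq com com
  | If test com com
  | While test com

type_synonym store = "nat \<Rightarrow> val"

fun num_of :: "val \<Rightarrow> real" where
  "num_of (Num x) = x"
| "num_of _ = 0"

fun hd_of :: "val \<Rightarrow> val" where
  "hd_of (Cell v w) = v"
| "hd_of _ = Leaf"

fun tl_of :: "val \<Rightarrow> val" where
  "tl_of (Cell v w) = w"
| "tl_of _ = Leaf"

fun is_cell :: "val \<Rightarrow> bool" where
  "is_cell (Cell v w) \<longleftrightarrow> True"
| "is_cell _ \<longleftrightarrow> False"

primrec expr_val :: "expr \<Rightarrow> store \<Rightarrow> val" where
  "expr_val (Var x) s = s x"
| "expr_val (Lit k) s = Num (of_int k)"
| "expr_val Empty s = Leaf"
| "expr_val (Pair e f) s = Cell (expr_val e s) (expr_val f s)"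
| "expr_val (Hd e) s = hd_of (expr_val e s)"
| "expr_val (Tl e) s = tl_of (expr_val e s)"
| "expr_val (Add e f) s = Num (num_of (expr_val e s) + num_of (expr_val f s))"
| "expr_val (Sub e f) s = Num (num_of (expr_val e s) - num_of (expr_val f s))"
| "expr_val (Mul e f) s = Num (num_of (expr_val e s) * num_of (expr_val f s))"
| "expr_val (Div e f) s = Num (num_of (expr_val e s) / num_of (expr_val f s))"

primrec test_val :: "test \<Rightarrow> store \<Rightarrow> bool" where
  "test_val (IsCell e) s \<longleftrightarrow> is_cell (expr_val e s)"
| "test_val (Leq e f) s \<longleftrightarrow> num_of (expr_val e s) \<le> num_of (expr_val f s)"
| "test_val (Neg b) s \<longleftrightarrow> \<not> test_val b s"
| "test_val (Conj b c) s \<longleftrightarrow> test_val b s \<and> test_val c s"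

text \<open>
  \<open>exec S T c s t s'\<close>: started in \<open>s\<close>, program \<open>c\<close> terminates in \<open>s'\<close> after time \<open>t\<close>. Evaluating an
  expression or test costs \<open>1\<close>: those of a fixed program have bounded size, so this changes running
  times by a constant factor only. A call of the solver additionally costs the solver's time.
\<close>

inductive exec ::
  "(val \<Rightarrow> val) \<Rightarrow> (val \<Rightarrow> nat) \<Rightarrow> com \<Rightarrow> store \<Rightarrow> nat \<Rightarrow> store \<Rightarrow> bool"
  for S T where
  Skip: "exec S T Skip s 1 s"
| Assign: "exec S T (Assign x e) s 1 (s(x := expr_val e s))"
| Solve: "exec S T (Solve x e) s (1 + T (expr_val e s)) (s(x := S (expr_val e s)))"
| Seq: "exec S T c s t s' \<Longrightarrow> exec S T d s' t' s'' \<Longrightarrow> exec S T (Seq c d) s (t + t') s''"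
| IfTrue: "test_val b s \<Longrightarrow> exec S T c s t s' \<Longrightarrow> exec S T (If b c d) s (1 + t) s'"
| IfFalse: "\<not> test_val b s \<Longrightarrow> exec S T d s t s' \<Longrightarrow> exec S T (If b c d) s (1 + t) s'"
| WhileFalse: "\<not> test_val b s \<Longrightarrow> exec S T (While b c) s 1 s"
| WhileTrue: "test_val b s \<Longrightarrow> exec S T c s t s' \<Longrightarrow> exec S T (While b c) s' t' s'' \<Longrightarrow>
    exec S T (While b c) s (1 + t + t') s''"

lemma exec_deterministic:
  "exec S T c s t s' \<Longrightarrow> exec S T c s u s'' \<Longrightarrow> u = t \<and> s'' = s'"
proof (induction arbitrary: u s'' rule: exec.induct)
  case Skip
  then show ?case by cases auto
next
  case Assign
  then show ?case by cases auto
next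
  case Solve
  then show ?case by cases auto
next
  case Seq
  from Seq.prems show ?case by cases (metis Seq.IH)
next
  case IfTrue
  from IfTrue.prems show ?case by cases (use IfTrue.IH IfTrue.hyps in metis)+
next
  case IfFalse
  from IfFalse.prems show ?case by cases (use IfFalse.IH IfFalse.hyps in metis)+
next
  case WhileFalse
  from WhileFalse.prems show ?case by cases (use WhileFalse.hyps in auto)
next
  case WhileTrue
  from WhileTrue.prems show ?case by cases (use WhileTrue.IH WhileTrue.hyps in metis)+
qed

text \<open>
  Input and output are in variable \<open>0\<close>, all other variables are initially \<open>Leaf\<close>. One program has
  to work with every polynomial-time solver for exponential cone programs.
\<close>

definition polytime_solvable :: "('i \<Rightarrow> val) \<Rightarrow> ('i \<Rightarrow> val set) \<Rightarrow> 'i set \<Rightarrow> bool" where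
  "polytime_solvable enc answers Is \<longleftrightarrow>
     (\<exists>c. \<forall>S T. ecp_solver S T \<longrightarrow>
        (\<exists>q :: nat poly. \<forall>i\<in>Is. \<exists>t s'.
           exec S T c ((\<lambda>_. Leaf)(0 := enc i)) t s' \<and>
           t \<le> poly q (val_size (enc i)) \<and> s' 0 \<in> answers i))"


section \<open>The problem SSD(C/TR)-ECP\<close>

text \<open>
  Demand points and regimes are numbered; values of the data outside these index sets are
  irrelevant.
\<close>

record ssd =
  n_pts :: nat
  n_regs :: nat
  rate :: "nat \<Rightarrow> real"
  cost :: "nat \<Rightarrow> real"
  kappa :: real
  eps :: real
  access :: "nat \<Rightarrow> real"
  thresh :: "nat \<Rightarrow> real"
  tol :: "nat \<Rightarrow> real"
  beta :: real
  gamma :: real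
  budget :: real  \<comment> \<open>\<open>\<Gamma>\<close>\<close>
  edges :: "nat set set"

definition points :: "ssd \<Rightarrow> nat set" where
  "points I = {..<n_pts I}"

definition regimes :: "ssd \<Rightarrow> nat set" where
  "regimes I = {..<n_regs I}"

definition weight :: "ssd \<Rightarrow> nat \<Rightarrow> real" where
  "weight I r = rate I r / (\<Sum>r'\<in>regimes I. rate I r')"

definition valid_ssd :: "ssd \<Rightarrow> bool" where
  "valid_ssd I \<longleftrightarrow>
     (\<forall>r\<in>regimes I. rate I r \<ge> 0 \<and> cost I r \<ge> 0) \<and> (\<Sum>r\<in>regimes I. rate I r) > 0 \<and>
     kappa I \<ge> 0 \<and> eps I > 0 \<and>
     (\<forall>a\<in>points I. access I a \<ge> 0 \<and> thresh I a \<ge> access I a \<and> 0 \<le> tol I a \<and> tol I a \<le> 1) \<and>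
     0 < beta I \<and> beta I \<le> 1 \<and> 0 \<le> gamma I \<and> gamma I < 1 \<and>
     \<lfloor>(1 - gamma I) * real (card (points I))\<rfloor> \<ge> 1 \<and> budget I \<ge> 0 \<and>
     (\<forall>e\<in>edges I. \<exists>a\<in>points I. \<exists>a'\<in>points I. a \<noteq> a' \<and> e = {a, a'})"

record ssd_sol =
  mu :: "nat \<Rightarrow> real"
  nu :: "nat \<Rightarrow> real"
  ell :: "nat \<Rightarrow> real"
  tau :: "nat \<Rightarrow> real"
  zeta :: "nat \<Rightarrow> nat \<Rightarrow> real"
  uu :: "nat \<Rightarrow> nat \<Rightarrow> real"  \<comment> \<open>\<open>u\<^sub>a\<^sub>r\<close>\<close>
  sel :: "nat \<Rightarrow> real"  \<comment> \<open>\<open>s\<^sub>a\<close>\<close>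
  resp :: "nat \<Rightarrow> real"  \<comment> \<open>\<open>r\<^sub>a\<close>\<close>
  excess :: "nat \<Rightarrow> real"  \<comment> \<open>\<open>U\<^sub>a\<close>\<close>
  eta :: real

definition ssd_feasible :: "ssd \<Rightarrow> ssd_sol set" where
  "ssd_feasible I = {X.
     (\<forall>r\<in>regimes I. mu X r - rate I r \<ge> eps I) \<and>
     (\<forall>a\<in>points I. (\<Sum>r\<in>regimes I. weight I r * zeta X a r) \<le> 1 + (tol I a - 1) * sel X a) \<and>
     (\<forall>a\<in>points I. \<forall>r\<in>regimes I.
        uu X a r = - (mu X r - rate I r) * (thresh I a - access I a) \<and>
        (zeta X a r, sel X a, uu X a r) \<in> K_exp) \<and>
     (\<Sum>a\<in>points I. sel X a) \<ge> of_int \<lceil>beta I * real (card (points I))\<rceil> \<and>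
     (\<forall>a a'. {a, a'} \<in> edges I \<longrightarrow> sel X a + sel X a' \<le> 1) \<and>
     (\<forall>a\<in>points I.
        resp X a \<ge> access I a + (\<Sum>r\<in>regimes I. weight I r * tau X r) \<and>
        excess X a \<ge> resp X a - eta X) \<and>
     eta X + 1 / of_int \<lfloor>(1 - gamma I) * real (card (points I))\<rfloor> * (\<Sum>a\<in>points I. excess X a)
       \<le> budget I \<and>
     (\<forall>r\<in>regimes I.
        nu X r + ell X r \<ge> 0 \<and> (tau X r, 1, ell X r) \<in> K_exp \<and>
        (mu X r - rate I r, 1, nu X r) \<in> K_exp) \<and>
     (\<forall>r\<in>regimes I. mu X r \<ge> 0 \<and> nu X r \<ge> 0 \<and> ell X r \<ge> 0 \<and> tau X r \<ge> 0) \<and>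
     (\<forall>a\<in>points I. excess X a \<ge> 0 \<and> resp X a \<ge> 0) \<and>
     eta X \<ge> 0 \<and>
     (\<forall>a\<in>points I. sel X a \<in> {0, 1})}"

definition ssd_objective :: "ssd \<Rightarrow> ssd_sol \<Rightarrow> real" where
  "ssd_objective I X =
     (\<Sum>r\<in>regimes I. cost I r * mu X r) - kappa I * (\<Sum>r\<in>regimes I. nu X r)"

text \<open>The conflict graph is given by its adjacency matrix.\<close>

definition enc_ssd :: "ssd \<Rightarrow> val" where
  "enc_ssd I = (let m = n_pts I; n = n_regs I in enc_list
     [enc_vec n (rate I), enc_vec n (cost I), Num (kappa I), Num (eps I),
      enc_vec m (access I), enc_vec m (thresh I), enc_vec m (tol I),
      Num (beta I), Num (gamma I), Num (budget I),
      enc_mat m m (\<lambda>a a'. of_bool ({a, a'} \<in> edges I))])"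

definition enc_ssd_sol :: "ssd \<Rightarrow> ssd_sol \<Rightarrow> val" where
  "enc_ssd_sol I X = (let m = n_pts I; n = n_regs I in enc_list
     [enc_vec n (mu X), enc_vec n (nu X), enc_vec n (ell X), enc_vec n (tau X),
      enc_mat m n (zeta X), enc_mat m n (uu X),
      enc_vec m (sel X), enc_vec m (resp X), enc_vec m (excess X), Num (eta X)])"

definition ssd_answers :: "ssd \<Rightarrow> val set" where
  "ssd_answers I =
     enc_outcome (enc_ssd_sol I) ` {r. correct_outcome (ssd_feasible I) (ssd_objective I) r}"

end

theory Submission
  imports Defs
begin

text \<open>
  Without conflicts and with a common tolerance, only the gaps
  \<open>g\<^sub>a = t\<^sup>\<star>\<^sub>a - t\<^sub>a\<close> distinguish the demand points: for given service rates, point \<open>a\<close> can be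
  selected iff \<open>\<Sum>\<^sub>r \<pi>\<^sub>r exp (- (\<mu>\<^sub>r - \<Lambda>\<^sub>r) g\<^sub>a) \<le> \<alpha>\<close>, and the left-hand side decreases in \<open>g\<^sub>a\<close>. So if some
  selection of the required size is possible, selecting the points with the largest gaps is possible
  as well. Which points these are depends on the gaps and on \<open>\<beta>\<close> only, and of all constraints
  attached to them the one for the smallest selected gap (\<open>cutoff\<close>) implies the others. This
  disposes of the binary variables.

  The response time constraints become a condition on the data. As \<open>\<ell>\<^sub>r \<ge> 0\<close> forces \<open>\<tau>\<^sub>r \<ge> 1\<close> and the
  weights sum to \<open>1\<close>, the choice \<open>\<ell>\<^sub>r = 0\<close>, \<open>\<tau>\<^sub>r = 1\<close> is the best one, and then, with
  \<open>k = \<lfloor>(1 - \<gamma>) |\<A>|\<rfloor>\<close>, the least possible value of \<open>\<eta> + 1/k \<Sum>\<^sub>a U\<^sub>a\<close> is the conditional value at risk of \<open>1 + t\<^sub>a\<close>, attained with \<open>\<eta>\<close> at the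
  \<open>k\<close>-th largest of these numbers (\<open>excess_sum_ge\<close>).

  What remains is an exponential cone program with three variables per regime, \<open>reduced_ecp\<close>.
  Its feasible points lift to feasible solutions with the same objective value
  (\<open>lift_sol_feasible\<close>), and every feasible solution has the objective value of some
  feasible point (\<open>reduced_ecp_exact\<close>); hence every outcome of the small program, including an
  unattained infimum, is carried over (\<open>correct_outcome_transfer\<close>). The lift uses field operations
  and comparisons only: as no exponential can be evaluated, the values \<open>\<zeta>\<^sub>a\<^sub>r\<close> of all
  selected points are copied from the cone variable that belongs to the smallest selected gap.

  The program for this reduction is obtained from closure properties. \<open>ptime D In f\<close> says that some
  program computes \<open>f x\<close> from \<open>In x\<close> for all \<open>x \<in> D\<close> in polynomial time and with polynomial output
  size. It is closed under pairing, arithmetic, case distinction, composition and bounded loops, so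
  that \<open>ptime\<close> of the construction of \<open>reduced_ecp\<close> and of the lift follows along their definitions.
\<close>

section \<open>Polynomial bounds and running times\<close>

text \<open>
  Inputs are values \<open>x\<close> of any type, presented to programs as \<open>In x\<close>. Bounds are only claimed on
  \<open>D\<close>, which thereby acts as a precondition on inputs.
\<close>

definition polybdd :: "'a set \<Rightarrow> ('a \<Rightarrow> val) \<Rightarrow> ('a \<Rightarrow> nat) \<Rightarrow> bool" where
  "polybdd D In b \<longleftrightarrow> (\<exists>p. \<forall>x\<in>D. b x \<le> poly p (val_size (In x)))"

lemma poly_nat_mono: "x \<le> y \<Longrightarrow> poly (p :: nat poly) x \<le> poly p y"
  by (induction p) (auto intro!: mult_mono add_mono)

lemma polybdd_mono:
  "polybdd D In b \<Longrightarrow> (\<And>x. x \<in> D \<Longrightarrow> b' x \<le> b x) \<Longrightarrow> polybdd D In b'"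
  unfolding polybdd_def by (meson order_trans)

lemma polybdd_subset: "polybdd D In b \<Longrightarrow> D' \<subseteq> D \<Longrightarrow> polybdd D' In b"
  unfolding polybdd_def by blast

lemma polybdd_const: "polybdd D In (\<lambda>_. c)"
  unfolding polybdd_def by (rule exI[of _ "[:c:]"]) simp

lemma polybdd_size: "polybdd D In (\<lambda>x. val_size (In x))"
  unfolding polybdd_def by (rule exI[of _ "[:0, 1:]"]) simp

lemma polybdd_add:
  "polybdd D In b \<Longrightarrow> polybdd D In c \<Longrightarrow> polybdd D In (\<lambda>x. b x + c x)"
  unfolding polybdd_def by (metis add_mono poly_add)

lemma polybdd_mult:
  "polybdd D In b \<Longrightarrow> polybdd D In c \<Longrightarrow> polybdd D In (\<lambda>x. b x * c x)"
  unfolding polybdd_def by (metis mult_mono poly_mult zero_le)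

lemma polybdd_poly:
  assumes "polybdd D In b"
  shows "polybdd D In (\<lambda>x. poly p (b x))"
proof -
  obtain q where "\<forall>x\<in>D. b x \<le> poly q (val_size (In x))"
    using assms by (auto simp: polybdd_def)
  then have "\<forall>x\<in>D. poly p (b x) \<le> poly (pcompose p q) (val_size (In x))"
    by (simp add: poly_pcompose poly_nat_mono)
  then show ?thesis unfolding polybdd_def by blast
qed

lemmas polybdd_intros = polybdd_const polybdd_size polybdd_add polybdd_mult polybdd_poly

text \<open>
  A total-correctness statement with a time bound, in weakest-precondition form: the rule for \<open>Seq\<close>
  below nests it in the postcondition, so that programs are verified by applying rules from left to
  right.
\<close>

definition ends_within ::
  "(val \<Rightarrow> val) \<Rightarrow> (val \<Rightarrow> nat) \<Rightarrow> com \<Rightarrow> store \<Rightarrow> nat \<Rightarrow> (store \<Rightarrow> bool) \<Rightarrow> bool" where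
  "ends_within S T c s n Q \<longleftrightarrow> (\<exists>t s'. exec S T c s t s' \<and> t \<le> n \<and> Q s')"

lemma ends_within_mono:
  "ends_within S T c s n Q \<Longrightarrow> n \<le> n' \<Longrightarrow> (\<And>s'. Q s' \<Longrightarrow> Q' s') \<Longrightarrow> ends_within S T c s n' Q'"
  unfolding ends_within_def by (meson order_trans)

lemma ends_within_Skip: "Q s \<Longrightarrow> 0 < n \<Longrightarrow> ends_within S T Skip s n Q"
  unfolding ends_within_def using exec.Skip[of S T s] by (metis Suc_leI One_nat_def)

lemma ends_within_Assign:
  "Q (s(x := expr_val e s)) \<Longrightarrow> 0 < n \<Longrightarrow> ends_within S T (Assign x e) s n Q"
  unfolding ends_within_def using exec.Assign[of S T x e s] by (metis Suc_leI One_nat_def)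

lemma ends_within_Solve:
  "Q (s(x := S (expr_val e s))) \<Longrightarrow> ends_within S T (Solve x e) s (1 + T (expr_val e s)) Q"
  unfolding ends_within_def by (meson exec.Solve order_refl)

lemma ends_within_Seq:
  "ends_within S T c s n (\<lambda>s'. ends_within S T d s' m Q) \<Longrightarrow>
   ends_within S T (Seq c d) s (n + m) Q"
  unfolding ends_within_def by (meson exec.Seq add_mono)

lemma ends_within_If:
  assumes "test_val b s \<Longrightarrow> ends_within S T c s n Q"
    and "\<not> test_val b s \<Longrightarrow> ends_within S T d s n Q"
  shows "ends_within S T (If b c d) s (1 + n) Q"
proof (cases "test_val b s")
  case True
  then show ?thesis
    using assms(1) unfolding ends_within_def by (meson exec.IfTrue add_left_mono)
next
  case False
  then show ?thesis
    using assms(2) unfolding ends_within_def by (meson exec.IfFalse add_left_mono)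
qed

text \<open>
  \<open>Inv j\<close> holds when \<open>j\<close> iterations are left, each of which takes time at most \<open>B\<close>.
\<close>

lemma ends_within_While:
  assumes "\<And>j s. j < n \<Longrightarrow> Inv (Suc j) s \<Longrightarrow> test_val b s \<and> ends_within S T c s B (Inv j)"
    and "\<And>s. Inv 0 s \<Longrightarrow> \<not> test_val b s"
    and "Inv n s"
  shows "ends_within S T (While b c) s (1 + n * (1 + B)) (Inv 0)"
  using assms(1,3)
proof (induction n arbitrary: s)
  case 0
  then show ?case
    using exec.WhileFalse[OF assms(2)] unfolding ends_within_def by fastforce
next
  case (Suc n)
  from Suc.prems obtain t s' where 1: "exec S T c s t s'" "t \<le> B" "Inv n s'" "test_val b s"
    unfolding ends_within_def by blast
  have "ends_within S T (While b c) s' (1 + n * (1 + B)) (Inv 0)"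
    using Suc.prems(1) less_SucI 1(3) by (intro Suc.IH) blast+
  then obtain t' s'' where 2: "exec S T (While b c) s' t' s''" "t' \<le> 1 + n * (1 + B)" "Inv 0 s''"
    unfolding ends_within_def by blast
  have "exec S T (While b c) s (1 + t + t') s''"
    using 1 2 by (intro exec.WhileTrue)
  moreover have "1 + t + t' \<le> 1 + Suc n * (1 + B)"
    using 1(2) 2(2) by simp
  ultimately show ?case
    unfolding ends_within_def using 2(3) by blast
qed

text \<open>
  A program is given for every base register \<open>k\<close>. It replaces its input in \<open>k\<close> by its output and may use
  all registers above \<open>k\<close>, but preserves those below. Programs therefore nest like stack frames: a
  caller keeps its data at and above \<open>k\<close> and calls others at a higher base.
\<close>

definition computes ::
  "(nat \<Rightarrow> com) \<Rightarrow> ('a \<Rightarrow> nat) \<Rightarrow> 'a set \<Rightarrow> ('a \<Rightarrow> val) \<Rightarrow> ('a \<Rightarrow> val) \<Rightarrow> bool" where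
  "computes C b D In f \<longleftrightarrow> (\<forall>x\<in>D. \<forall>S T k s. s k = In x \<longrightarrow>
     ends_within S T (C k) s (b x) (\<lambda>s'. s' k = f x \<and> (\<forall>j<k. s' j = s j)))"

lemma computesD:
  assumes "computes C b D In f" "x \<in> D" "s k = In x"
    and "\<And>s'. s' k = f x \<Longrightarrow> (\<And>j. j < k \<Longrightarrow> s' j = s j) \<Longrightarrow> Q s'"
  shows "ends_within S T (C k) s (b x) Q"
proof -
  have "ends_within S T (C k) s (b x) (\<lambda>s'. s' k = f x \<and> (\<forall>j<k. s' j = s j))"
    using assms(1-3) unfolding computes_def by simp
  then show ?thesis
    by (rule ends_within_mono) (simp_all add: assms(4))
qed

text \<open>
  The output size has to be bounded separately, because one unit-cost assignment can double the size
  of a tree. Without this bound polynomial running time would not be closed under composition.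
\<close>

definition ptime :: "'a set \<Rightarrow> ('a \<Rightarrow> val) \<Rightarrow> ('a \<Rightarrow> val) \<Rightarrow> bool" where
  "ptime D In f \<longleftrightarrow> polybdd D In (\<lambda>x. val_size (f x)) \<and>
     (\<exists>C b. polybdd D In b \<and> computes C b D In f)"

lemma ptime_sizeD: "ptime D In f \<Longrightarrow> polybdd D In (\<lambda>x. val_size (f x))"
  by (simp add: ptime_def)

lemma ptimeI:
  assumes "polybdd D In (\<lambda>x. val_size (f x))" and "polybdd D In b"
    and "\<And>x S T k s. x \<in> D \<Longrightarrow> s k = In x \<Longrightarrow>
      ends_within S T (C k) s (b x) (\<lambda>s'. s' k = f x \<and> (\<forall>j<k. s' j = s j))"
  shows "ptime D In f"
  using assms unfolding ptime_def computes_def by blast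

lemma ptimeE:
  assumes "ptime D In f"
  obtains C b where "polybdd D In b" and "computes C b D In f"
  using assms unfolding ptime_def by blast

lemma ptime_subset:
  assumes "ptime D In f" "D' \<subseteq> D"
  shows "ptime D' In f"
proof -
  obtain C b where b: "polybdd D In b" and C: "computes C b D In f"
    using assms(1) by (rule ptimeE)
  show ?thesis
    using assms(2)
    by (intro ptimeI[where C = C and b = b] polybdd_subset[OF b]
        polybdd_subset[OF ptime_sizeD[OF assms(1)]] computesD[OF C]) auto
qed

lemma ptime_cong:
  assumes "\<And>x. x \<in> D \<Longrightarrow> f x = g x" "ptime D In g"
  shows "ptime D In f"
proof -
  obtain C b where b: "polybdd D In b" and C: "computes C b D In g"
    using assms(2) by (rule ptimeE)
  show ?thesis
    by (intro ptimeI[where C = C and b = b] b polybdd_mono[OF ptime_sizeD[OF assms(2)]] computesD[OF C])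
      (auto simp: assms(1))
qed

lemma ptime_id: "ptime D In In"
  by (rule ptimeI[where C = "\<lambda>_. Skip" and b = "\<lambda>_. 1"])
    (auto intro: polybdd_intros ends_within_Skip)

lemma polybdd_reindex:
  assumes "polybdd D' In' b" "\<And>x. x \<in> D \<Longrightarrow> h x \<in> D'"
    and "polybdd D In (\<lambda>x. val_size (In' (h x)))"
  shows "polybdd D In (\<lambda>x. b (h x))"
proof -
  obtain p where p: "\<forall>y\<in>D'. b y \<le> poly p (val_size (In' y))"
    using assms(1) by (auto simp: polybdd_def)
  show ?thesis
    by (rule polybdd_mono[OF polybdd_poly[OF assms(3), of p]]) (use p assms(2) in blast)
qed

text \<open>
  Composition and change of the input type in one: \<open>f\<close> is computed from inputs of another type, and
  \<open>h x\<close> is the one to which \<open>x\<close> is translated.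
\<close>

lemma ptime_compose:
  assumes f: "ptime D' In' f" and h: "ptime D In (\<lambda>x. In' (h x))"
    and dom: "\<And>x. x \<in> D \<Longrightarrow> h x \<in> D'"
  shows "ptime D In (\<lambda>x. f (h x))"
proof -
  obtain C b where b: "polybdd D' In' b" and C: "computes C b D' In' f"
    using f by (rule ptimeE)
  obtain C' b' where b': "polybdd D In b'" and C': "computes C' b' D In (\<lambda>x. In' (h x))"
    using h by (rule ptimeE)
  show ?thesis
  proof (rule ptimeI[where C = "\<lambda>k. Seq (C' k) (C k)" and b = "\<lambda>x. b' x + b (h x)"])
    show "polybdd D In (\<lambda>x. val_size (f (h x)))"
      by (rule polybdd_reindex[OF ptime_sizeD[OF f] dom ptime_sizeD[OF h]])
    show "polybdd D In (\<lambda>x. b' x + b (h x))"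
      by (intro polybdd_add b' polybdd_reindex[OF b dom ptime_sizeD[OF h]])
    fix x S T and k :: nat and s :: store assume "x \<in> D" "s k = In x"
    then show "ends_within S T (Seq (C' k) (C k)) s (b' x + b (h x))
        (\<lambda>s'. s' k = f (h x) \<and> (\<forall>j<k. s' j = s j))"
      by (intro ends_within_Seq computesD[OF C', where x = x] computesD[OF C, where x = "h x"]) (auto simp: dom)
  qed
qed

lemma ptime_expr:
  assumes f: "ptime D In f"
    and e: "\<And>k s. expr_val (e k) s = h (s k)"
    and size: "\<And>v. val_size (h v) \<le> c + val_size v"
  shows "ptime D In (\<lambda>x. h (f x))"
proof -
  obtain C b where b: "polybdd D In b" and C: "computes C b D In f"
    using f by (rule ptimeE)
  have "polybdd D In (\<lambda>x. c + val_size (f x))"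
    by (intro polybdd_intros ptime_sizeD[OF f])
  then have size': "polybdd D In (\<lambda>x. val_size (h (f x)))"
    by (rule polybdd_mono) (rule size)
  show ?thesis
  proof (rule ptimeI[where C = "\<lambda>k. Seq (C k) (Assign k (e k))" and b = "\<lambda>x. b x + 1", OF size'])
    show "polybdd D In (\<lambda>x. b x + 1)"
      by (intro polybdd_intros b)
    fix x S T and k :: nat and s :: store assume "x \<in> D" "s k = In x"
    then show "ends_within S T (Seq (C k) (Assign k (e k))) s (b x + 1)
        (\<lambda>s'. s' k = h (f x) \<and> (\<forall>j<k. s' j = s j))"
      by (intro ends_within_Seq computesD[OF C, where x = x] ends_within_Assign) (auto simp: e)
  qed
qed

lemma ptime_Cell:
  assumes f: "ptime D In f" and g: "ptime D In g"
  shows "ptime D In (\<lambda>x. Cell (f x) (g x))"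
proof -
  obtain C b where b: "polybdd D In b" and C: "computes C b D In f"
    using f by (rule ptimeE)
  obtain C' b' where b': "polybdd D In b'" and C': "computes C' b' D In g"
    using g by (rule ptimeE)
  show ?thesis
  proof (rule ptimeI[where C = "\<lambda>k. Seq (Assign (k + 1) (Var k)) (Seq (C (k + 1))
          (Seq (Assign (k + 2) (Var k)) (Seq (C' (k + 2))
          (Assign k (Pair (Var (k + 1)) (Var (k + 2)))))))"
        and b = "\<lambda>x. 1 + (b x + (1 + (b' x + 1)))"])
    have "polybdd D In (\<lambda>x. 1 + (val_size (f x) + val_size (g x)))"
      by (intro polybdd_intros ptime_sizeD[OF f] ptime_sizeD[OF g])
    then show "polybdd D In (\<lambda>x. val_size (Cell (f x) (g x)))"
      by simp
    show "polybdd D In (\<lambda>x. 1 + (b x + (1 + (b' x + 1))))"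
      by (intro polybdd_intros b b')
    fix x S T and k :: nat and s :: store assume "x \<in> D" "s k = In x"
    then show "ends_within S T (Seq (Assign (k + 1) (Var k)) (Seq (C (k + 1))
          (Seq (Assign (k + 2) (Var k)) (Seq (C' (k + 2))
          (Assign k (Pair (Var (k + 1)) (Var (k + 2)))))))) s (1 + (b x + (1 + (b' x + 1))))
        (\<lambda>s'. s' k = Cell (f x) (g x) \<and> (\<forall>j<k. s' j = s j))"
      by (intro ends_within_Seq ends_within_Assign computesD[OF C, where x = x] computesD[OF C', where x = x]) auto
  qed
qed

text \<open>
  Each branch need only be computable on the inputs that reach it.
\<close>

lemma ptime_If:
  assumes a: "ptime D In (\<lambda>x. Num (a x))" and b: "ptime D In (\<lambda>x. Num (b x))"
    and f: "ptime {x \<in> D. a x \<le> b x} In f" and g: "ptime {x \<in> D. \<not> a x \<le> b x} In g"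
  shows "ptime D In (\<lambda>x. if a x \<le> b x then f x else g x)"
proof -
  obtain C u where u: "polybdd D In u" and C: "computes C u D In (\<lambda>x. Cell (Num (a x)) (Num (b x)))"
    using ptime_Cell[OF a b] by (rule ptimeE)
  obtain C1 b1 where b1: "polybdd {x \<in> D. a x \<le> b x} In b1" and C1: "computes C1 b1 {x \<in> D. a x \<le> b x} In f"
    using f by (rule ptimeE)
  obtain C2 b2 where b2: "polybdd {x \<in> D. \<not> a x \<le> b x} In b2" and C2: "computes C2 b2 {x \<in> D. \<not> a x \<le> b x} In g"
    using g by (rule ptimeE)
  have bdd_if: "polybdd D In (\<lambda>x. if a x \<le> b x then c x else d x)"
    if cd: "polybdd {x \<in> D. a x \<le> b x} In c" "polybdd {x \<in> D. \<not> a x \<le> b x} In d" for c d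
  proof -
    from cd obtain p q where "\<forall>x\<in>{x \<in> D. a x \<le> b x}. c x \<le> poly p (val_size (In x))"
      "\<forall>x\<in>{x \<in> D. \<not> a x \<le> b x}. d x \<le> poly q (val_size (In x))"
      unfolding polybdd_def by blast
    then have "\<forall>x\<in>D. (if a x \<le> b x then c x else d x) \<le> poly (p + q) (val_size (In x))"
      by (auto intro: trans_le_add1 trans_le_add2)
    then show ?thesis unfolding polybdd_def by blast
  qed
  show ?thesis
  proof (rule ptimeI[where C = "\<lambda>k. Seq (Assign (k + 1) (Var k)) (Seq (C (k + 1))
          (If (Leq (Hd (Var (k + 1))) (Tl (Var (k + 1)))) (C1 k) (C2 k)))"
        and b = "\<lambda>x. 1 + (u x + (1 + (if a x \<le> b x then b1 x else b2 x)))"])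
    show "polybdd D In (\<lambda>x. val_size (if a x \<le> b x then f x else g x))"
      using bdd_if[OF ptime_sizeD[OF f] ptime_sizeD[OF g]] by (simp add: if_distrib)
    show "polybdd D In (\<lambda>x. 1 + (u x + (1 + (if a x \<le> b x then b1 x else b2 x))))"
      by (intro polybdd_intros u bdd_if b1 b2)
    fix x S T and k :: nat and s :: store assume "x \<in> D" "s k = In x"
    then show "ends_within S T (Seq (Assign (k + 1) (Var k)) (Seq (C (k + 1))
          (If (Leq (Hd (Var (k + 1))) (Tl (Var (k + 1)))) (C1 k) (C2 k)))) s
        (1 + (u x + (1 + (if a x \<le> b x then b1 x else b2 x))))
        (\<lambda>s'. s' k = (if a x \<le> b x then f x else g x) \<and> (\<forall>j<k. s' j = s j))"
      by (intro ends_within_Seq ends_within_Assign computesD[OF C, where x = x] ends_within_If)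
        (auto intro!: computesD[OF C1] computesD[OF C2])
  qed
qed

text \<open>
  A loop that counts \<open>i\<close> down from \<open>n x\<close> performs a right fold over \<open>0, ..., n x - 1\<close>, which makes a
  table come out in the right order. The body sees the index, the accumulator and the input, and may
  assume that the accumulator is the fold over the larger indices. A polynomially growing body could
  still blow up the accumulator under iteration; hence the bound \<open>B\<close> on all intermediate results.
\<close>

lemma ptime_foldr:
  fixes F :: "'a \<Rightarrow> nat \<Rightarrow> val \<Rightarrow> val"
  assumes n: "ptime D In (\<lambda>x. Num (real (n x)))" "polybdd D In n"
    and a: "ptime D In a"
    and F: "ptime {(x, i, v). x \<in> D \<and> i < n x \<and> v = foldr (F x) [Suc i..<n x] (a x)}
        (\<lambda>(x, i, v). Cell (Num (real i)) (Cell v (In x))) (\<lambda>(x, i, v). F x i v)"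
    and B: "polybdd D In B"
      "\<And>x i. x \<in> D \<Longrightarrow> i \<le> n x \<Longrightarrow> val_size (foldr (F x) [i..<n x] (a x)) \<le> B x"
  shows "ptime D In (\<lambda>x. foldr (F x) [0..<n x] (a x))"
proof -
  let ?acc = "\<lambda>x i. foldr (F x) [i..<n x] (a x)"
  obtain Cn bn where bn: "polybdd D In bn" and Cn: "computes Cn bn D In (\<lambda>x. Num (real (n x)))"
    using n(1) by (rule ptimeE)
  obtain Ca ba where ba: "polybdd D In ba" and Ca: "computes Ca ba D In a"
    using a by (rule ptimeE)
  obtain CF bF where bF: "polybdd {(x, i, v). x \<in> D \<and> i < n x \<and> v = ?acc x (Suc i)}
        (\<lambda>(x, i, v). Cell (Num (real i)) (Cell v (In x))) bF" and CF: "computes CF bF {(x, i, v). x \<in> D \<and> i < n x \<and> v = ?acc x (Suc i)}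
        (\<lambda>(x, i, v). Cell (Num (real i)) (Cell v (In x))) (\<lambda>(x, i, v). F x i v)"
    using F by (rule ptimeE)
  from bF obtain p where p: "\<And>x i. x \<in> D \<Longrightarrow> i < n x \<Longrightarrow>
      bF (x, i, ?acc x (Suc i)) \<le> poly p (val_size (Cell (Num (real i)) (Cell (?acc x (Suc i)) (In x))))"
    unfolding polybdd_def by fastforce
  define bb where "bb x = poly p (3 + (B x + val_size (In x)))" for x
  have bb: "bF (x, i, ?acc x (Suc i)) \<le> bb x" if "x \<in> D" "i < n x" for x i
    unfolding bb_def using that B(2)[of x "Suc i"]
    by (intro order_trans[OF p] poly_nat_mono) auto
  \<comment> \<open>Registers: the input in k, the accumulator in k + 1, the counter in k + 2, a frame for the body from k + 3.\<close>
  define body where "body k = Seq (Assign (k + 2) (Sub (Var (k + 2)) (Lit 1)))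
      (Seq (Assign (k + 3) (Pair (Var (k + 2)) (Pair (Var (k + 1)) (Var k))))
      (Seq (CF (k + 3)) (Assign (k + 1) (Var (k + 3)))))" for k
  show ?thesis
  proof (rule ptimeI[where C = "\<lambda>k. Seq (Assign (k + 1) (Var k)) (Seq (Ca (k + 1))
          (Seq (Assign (k + 2) (Var k)) (Seq (Cn (k + 2))
          (Seq (While (Neg (Leq (Var (k + 2)) (Lit 0))) (body k)) (Assign k (Var (k + 1)))))))"
        and b = "\<lambda>x. 1 + (ba x + (1 + (bn x + (1 + n x * (1 + (1 + (1 + (bb x + 1)))) + 1))))"])
    show "polybdd D In (\<lambda>x. val_size (?acc x 0))"
      by (rule polybdd_mono[OF B(1)]) (rule B(2), auto)
    show "polybdd D In (\<lambda>x. 1 + (ba x + (1 + (bn x + (1 + n x * (1 + (1 + (1 + (bb x + 1)))) + 1)))))"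
      unfolding bb_def by (intro polybdd_intros ba bn n B)
    fix x S T and k :: nat and s :: store assume x: "x \<in> D" and s: "s k = In x"
    define Inv where "Inv j s' \<longleftrightarrow> s' (k + 2) = Num (real j) \<and> s' (k + 1) = ?acc x j \<and>
        (\<forall>i<k + 1. s' i = s i)" for j and s' :: store
    have step: "test_val (Neg (Leq (Var (k + 2)) (Lit 0))) s' \<and>
        ends_within S T (body k) s' (1 + (1 + (bb x + 1))) (Inv j)"
      if j: "j < n x" and "Inv (Suc j) s'" for j s'
    proof -
      have upt: "[j..<n x] = j # [Suc j..<n x]"
        using j by (simp add: upt_conv_Cons)
      have "ends_within S T (body k) s' (1 + (1 + (bF (x, j, ?acc x (Suc j)) + 1))) (Inv j)"
        unfolding body_def using that x s
        by (intro ends_within_Seq ends_within_Assign computesD[OF CF, where x = "(x, j, ?acc x (Suc j))"])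
          (auto simp: Inv_def upt intro!: ends_within_Assign)
      then show ?thesis
        using bb[OF x j] that(2) by (auto simp: Inv_def elim: ends_within_mono)
    qed
    have loop: "ends_within S T (While (Neg (Leq (Var (k + 2)) (Lit 0))) (body k)) s'
        (1 + n x * (1 + (1 + (1 + (bb x + 1))))) (Inv 0)" if "Inv (n x) s'" for s'
      by (rule ends_within_While[of "n x" Inv, OF step _ that]) (auto simp: Inv_def)
    show "ends_within S T (Seq (Assign (k + 1) (Var k)) (Seq (Ca (k + 1))
          (Seq (Assign (k + 2) (Var k)) (Seq (Cn (k + 2))
          (Seq (While (Neg (Leq (Var (k + 2)) (Lit 0))) (body k)) (Assign k (Var (k + 1)))))))) s
        (1 + (ba x + (1 + (bn x + (1 + n x * (1 + (1 + (1 + (bb x + 1)))) + 1)))))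
        (\<lambda>s'. s' k = ?acc x 0 \<and> (\<forall>j<k. s' j = s j))"
      using x s
      by (intro ends_within_Seq ends_within_Assign computesD[OF Ca, where x = x] computesD[OF Cn, where x = x]
          ends_within_mono[OF loop order_refl])
        (auto simp: Inv_def intro!: ends_within_Assign)
  qed
qed

section \<open>Arithmetic, tables and sums in polynomial time\<close>

lemma ptime_hd: "ptime D In f \<Longrightarrow> ptime D In (\<lambda>x. hd_of (f x))"
proof (erule ptime_expr[where e = "\<lambda>k. Hd (Var k)" and c = 1])
  show "val_size (hd_of v) \<le> 1 + val_size v" for v by (cases v) auto
qed simp

lemma ptime_tl: "ptime D In f \<Longrightarrow> ptime D In (\<lambda>x. tl_of (f x))"
proof (erule ptime_expr[where e = "\<lambda>k. Tl (Var k)" and c = 1])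
  show "val_size (tl_of v) \<le> 1 + val_size v" for v by (cases v) auto
qed simp

lemma ptime_Leaf: "ptime D In (\<lambda>_. Leaf)"
  by (rule ptime_expr[OF ptime_id, where e = "\<lambda>_. Empty" and c = 1]) auto

lemma ptime_int: "ptime D In (\<lambda>_. Num (of_int k))"
  by (rule ptime_expr[OF ptime_id, where e = "\<lambda>_. Lit k" and c = 1]) auto

lemma ptime_0: "ptime D In (\<lambda>_. Num 0)"
  and ptime_1: "ptime D In (\<lambda>_. Num 1)"
  and ptime_numeral: "ptime D In (\<lambda>_. Num (numeral w))"
  using ptime_int[of D In 0] ptime_int[of D In 1] ptime_int[of D In "numeral w"] by simp_all

lemma ptime_arith:
  assumes "ptime D In (\<lambda>x. Num (a x))" "ptime D In (\<lambda>x. Num (b x))"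
  shows ptime_add: "ptime D In (\<lambda>x. Num (a x + b x))"
    and ptime_diff: "ptime D In (\<lambda>x. Num (a x - b x))"
    and ptime_times: "ptime D In (\<lambda>x. Num (a x * b x))"
    and ptime_divide: "ptime D In (\<lambda>x. Num (a x / b x))"
proof -
  note ab = ptime_Cell[OF assms]
  show "ptime D In (\<lambda>x. Num (a x + b x))"
    using ptime_expr[OF ab, where e = "\<lambda>k. Add (Hd (Var k)) (Tl (Var k))"
        and h = "\<lambda>v. Num (num_of (hd_of v) + num_of (tl_of v))" and c = 1] by simp
  show "ptime D In (\<lambda>x. Num (a x - b x))"
    using ptime_expr[OF ab, where e = "\<lambda>k. Sub (Hd (Var k)) (Tl (Var k))"
        and h = "\<lambda>v. Num (num_of (hd_of v) - num_of (tl_of v))" and c = 1] by simp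
  show "ptime D In (\<lambda>x. Num (a x * b x))"
    using ptime_expr[OF ab, where e = "\<lambda>k. Mul (Hd (Var k)) (Tl (Var k))"
        and h = "\<lambda>v. Num (num_of (hd_of v) * num_of (tl_of v))" and c = 1] by simp
  show "ptime D In (\<lambda>x. Num (a x / b x))"
    using ptime_expr[OF ab, where e = "\<lambda>k. Div (Hd (Var k)) (Tl (Var k))"
        and h = "\<lambda>v. Num (num_of (hd_of v) / num_of (tl_of v))" and c = 1] by simp
qed

lemma ptime_uminus: "ptime D In (\<lambda>x. Num (a x)) \<Longrightarrow> ptime D In (\<lambda>x. Num (- a x))"
  using ptime_diff[OF ptime_0, of D In a] by simp

lemma ptime_of_bool_le:
  assumes "ptime D In (\<lambda>x. Num (a x))" "ptime D In (\<lambda>x. Num (b x))"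
  shows "ptime D In (\<lambda>x. Num (of_bool (a x \<le> b x)))"
  using ptime_If[OF assms ptime_1 ptime_0] by (rule ptime_cong[rotated]) simp

lemma ptime_max:
  assumes "ptime D In (\<lambda>x. Num (a x))" "ptime D In (\<lambda>x. Num (b x))"
  shows "ptime D In (\<lambda>x. Num (max (a x) (b x)))"
  using ptime_If[OF assms ptime_subset[OF assms(2)] ptime_subset[OF assms(1)]]
  by (rule ptime_cong[rotated]) (auto simp: max_def)

lemma length_le_val_size: "length vs \<le> val_size (enc_list vs)"
  by (induction vs) auto

lemma hd_tl_enc_list [simp]:
  "hd_of (enc_list (v # vs)) = v" "tl_of (enc_list vs) = enc_list (tl vs)"
  by (auto simp: enc_list_def split: list.splits) (cases vs; simp)

lemma is_cell_enc_list [simp]: "is_cell (enc_list vs) \<longleftrightarrow> vs \<noteq> []"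
  by (cases vs) auto

lemma polybdd_length:
  "ptime D In (\<lambda>x. enc_list (vs x)) \<Longrightarrow> polybdd D In (\<lambda>x. length (vs x))"
  by (erule polybdd_mono[OF ptime_sizeD]) (rule length_le_val_size)

text \<open>
  The only loop whose number of iterations is not known beforehand. Lengths computed here bound all
  other loops.
\<close>

lemma ptime_length:
  assumes "ptime D In (\<lambda>x. enc_list (vs x))"
  shows "ptime D In (\<lambda>x. Num (real (length (vs x))))"
proof -
  obtain C b where b: "polybdd D In b" and C: "computes C b D In (\<lambda>x. enc_list (vs x))"
    using assms by (rule ptimeE)
  let ?body = "\<lambda>k. Seq (Assign k (Tl (Var k))) (Assign (k + 1) (Add (Var (k + 1)) (Lit 1)))"
  let ?b = "\<lambda>x. b x + (1 + (1 + length (vs x) * (1 + (1 + 1)) + 1))"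
  show ?thesis
  proof (rule ptimeI[where C = "\<lambda>k. Seq (C k) (Seq (Assign (k + 1) (Lit 0))
      (Seq (While (IsCell (Var k)) (?body k)) (Assign k (Var (k + 1)))))" and b = ?b])
    show "polybdd D In (\<lambda>x. val_size (Num (real (length (vs x)))))"
      using polybdd_const[of D In 1] by simp
    show "polybdd D In ?b"
      by (intro polybdd_intros b polybdd_length[OF assms])
    fix x S T and k :: nat and s :: store assume x: "x \<in> D" "s k = In x"
    define Inv where "Inv j s' \<longleftrightarrow> j \<le> length (vs x) \<and>
        s' k = enc_list (drop (length (vs x) - j) (vs x)) \<and>
        s' (k + 1) = Num (real (length (vs x) - j)) \<and> (\<forall>i<k. s' i = s i)" for j and s' :: store
    have step: "test_val (IsCell (Var k)) s' \<and> ends_within S T (?body k) s' (1 + 1) (Inv j)"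
      if "Inv (Suc j) s'" for j s'
    proof -
      have "length (vs x) - j = Suc (length (vs x) - Suc j)"
        using that by (auto simp: Inv_def)
      then show ?thesis
        using that by (auto simp: Inv_def drop_Suc tl_drop
            intro!: ends_within_Seq[of _ _ _ _ 1, simplified] ends_within_Assign)
    qed
    have loop: "ends_within S T (While (IsCell (Var k)) (?body k)) s'
        (1 + length (vs x) * (1 + (1 + 1))) (Inv 0)" if "Inv (length (vs x)) s'" for s'
      by (rule ends_within_While[of "length (vs x)" Inv, OF step _ that]) (auto simp: Inv_def)
    show "ends_within S T (Seq (C k) (Seq (Assign (k + 1) (Lit 0))
        (Seq (While (IsCell (Var k)) (?body k)) (Assign k (Var (k + 1)))))) s (?b x)
        (\<lambda>s'. s' k = Num (real (length (vs x))) \<and> (\<forall>j<k. s' j = s j))"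
      using x
      by (intro ends_within_Seq ends_within_Assign computesD[OF C, where x = x]
          ends_within_mono[OF loop order_refl])
        (auto simp: Inv_def intro!: ends_within_Assign)
  qed
qed

text \<open>
  The input of a loop body that depends on an index but not on an accumulator.
\<close>

abbreviation indexed :: "('a \<Rightarrow> val) \<Rightarrow> 'a \<times> nat \<Rightarrow> val" where
  "indexed In \<equiv> \<lambda>p. Cell (Num (real (snd p))) (In (fst p))"

text \<open>
  The common pattern of tables, sums and maxima: a value \<open>F x i\<close> depending on the index is combined
  with the accumulator by a fixed operation.
\<close>

lemma ptime_fold_index:
  fixes F :: "'a \<Rightarrow> nat \<Rightarrow> val" and step :: "val \<Rightarrow> val \<Rightarrow> val"
  assumes n: "ptime D In (\<lambda>x. Num (real (n x)))" "polybdd D In n"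
    and a: "ptime D In a"
    and F: "ptime (SIGMA x:D. {..<n x}) (indexed In) (\<lambda>p. F (fst p) (snd p))"
    and step: "\<And>(E :: ('a \<times> nat \<times> val) set) J f g.
      ptime E J f \<Longrightarrow> ptime E J g \<Longrightarrow> ptime E J (\<lambda>x. step (f x) (g x))"
    and B: "polybdd D In B"
      "\<And>x i. x \<in> D \<Longrightarrow> i \<le> n x \<Longrightarrow>
        val_size (foldr (\<lambda>j. step (F x j)) [i..<n x] (a x)) \<le> B x"
  shows "ptime D In (\<lambda>x. foldr (\<lambda>i. step (F x i)) [0..<n x] (a x))"
proof (rule ptime_foldr[OF n a _ B])
  let ?E = "{(x, i, v). x \<in> D \<and> i < n x \<and> v = foldr (\<lambda>j. step (F x j)) [Suc i..<n x] (a x)}"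
  let ?J = "\<lambda>(x, i, v). Cell (Num (real i)) (Cell v (In x))"
  have J: "ptime ?E ?J ?J" by (rule ptime_id)
  have "ptime ?E ?J (\<lambda>y. hd_of (tl_of (?J y)))"
    by (intro ptime_hd ptime_tl J)
  then have v: "ptime ?E ?J (\<lambda>y. snd (snd y))"
    by (rule ptime_cong[rotated]) auto
  have "ptime ?E ?J (\<lambda>y. Cell (hd_of (?J y)) (tl_of (tl_of (?J y))))"
    by (intro ptime_Cell ptime_hd ptime_tl J)
  then have "ptime ?E ?J (\<lambda>y. indexed In (fst y, fst (snd y)))"
    by (rule ptime_cong[rotated]) auto
  from ptime_compose[OF F this] have "ptime ?E ?J (\<lambda>y. F (fst y) (fst (snd y)))"
    by auto
  from step[OF this v] show "ptime ?E ?J (\<lambda>(x, i, v). step (F x i) v)"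
    by (rule ptime_cong[rotated]) auto
qed

lemma enc_list_tabulate:
  "foldr (\<lambda>i. Cell (f i)) is (enc_list ys) = enc_list (map f is @ ys)"
  by (induction "is") auto

lemma val_size_enc_list: "val_size (enc_list vs) = 1 + (\<Sum>v\<leftarrow>vs. 1 + val_size v)"
  by (induction vs) auto

text \<open>
  Indices are real atoms of size \<open>1\<close>, so bounds for a loop body are uniform in the index.
\<close>

lemma polybdd_indexed:
  assumes "polybdd (SIGMA x:D. {..<n x}) (indexed In) b"
  obtains B where "polybdd D In B" "\<And>x i. x \<in> D \<Longrightarrow> i < n x \<Longrightarrow> b (x, i) \<le> B x"
proof -
  obtain p where p: "\<And>x i. x \<in> D \<Longrightarrow> i < n x \<Longrightarrow> b (x, i) \<le> poly p (2 + val_size (In x))"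
    using assms unfolding polybdd_def by fastforce
  show ?thesis
    by (rule that[of "\<lambda>x. poly p (2 + val_size (In x))", OF _ p])
      (intro polybdd_intros)
qed

text \<open>
  The table is put in front of an already computed list, which yields concatenations of tables
  without an append operation.
\<close>

lemma ptime_tabulate:
  fixes F :: "'a \<Rightarrow> nat \<Rightarrow> val"
  assumes n: "ptime D In (\<lambda>x. Num (real (n x)))" "polybdd D In n"
    and F: "ptime (SIGMA x:D. {..<n x}) (indexed In) (\<lambda>p. F (fst p) (snd p))"
    and ys: "ptime D In (\<lambda>x. enc_list (ys x))"
  shows "ptime D In (\<lambda>x. enc_list (map (F x) [0..<n x] @ ys x))"
proof -
  obtain B where B: "polybdd D In B" "\<And>x i. x \<in> D \<Longrightarrow> i < n x \<Longrightarrow> val_size (F x i) \<le> B x"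
    using polybdd_indexed[OF ptime_sizeD[OF F]] by auto
  have size: "val_size (foldr (\<lambda>j. Cell (F x j)) [i..<n x] (enc_list (ys x)))
      \<le> val_size (enc_list (ys x)) + n x * (1 + B x)" if "x \<in> D" "i \<le> n x" for x i
  proof -
    have "(\<Sum>v\<leftarrow>map (F x) [i..<n x]. 1 + val_size v) \<le> (\<Sum>j\<leftarrow>[i..<n x]. 1 + B x)"
      unfolding map_map using B(2) that by (intro sum_list_mono) auto
    also have "\<dots> = (n x - i) * (1 + B x)"
      by (simp only: sum_list_triv length_upt of_nat_id)
    also have "\<dots> \<le> n x * (1 + B x)"
      by (intro mult_right_mono) auto
    finally show ?thesis
      unfolding enc_list_tabulate val_size_enc_list map_append sum_list_append by linarith
  qed
  have "polybdd D In (\<lambda>x. val_size (enc_list (ys x)) + n x * (1 + B x))"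
    by (intro polybdd_intros B n ptime_sizeD[OF ys])
  from ptime_fold_index[where step = Cell, OF n ys F ptime_Cell this size]
  show ?thesis
    unfolding enc_list_tabulate .
qed

lemma foldr_Num_add:
  "foldr (\<lambda>i v. Num (num_of (Num (f i)) + num_of v)) is (Num 0) = Num (\<Sum>i\<leftarrow>is. f i)"
  by (induction "is") auto

lemma ptime_sum:
  fixes f :: "'a \<Rightarrow> nat \<Rightarrow> real"
  assumes n: "ptime D In (\<lambda>x. Num (real (n x)))" "polybdd D In n"
    and f: "ptime (SIGMA x:D. {..<n x}) (indexed In) (\<lambda>p. Num (f (fst p) (snd p)))"
  shows "ptime D In (\<lambda>x. Num (\<Sum>i<n x. f x i))"
proof -
  have "ptime D In (\<lambda>x. foldr (\<lambda>i v. Num (num_of (Num (f x i)) + num_of v)) [0..<n x] (Num 0))"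
  proof (rule ptime_fold_index[OF n ptime_0 f _ polybdd_const[of _ _ 1]])
    fix E :: "('a \<times> nat \<times> val) set" and J g h assume "ptime E J g" "ptime E J h"
    from ptime_expr[OF ptime_Cell[OF this], where e = "\<lambda>k. Add (Hd (Var k)) (Tl (Var k))"
        and h = "\<lambda>v. Num (num_of (hd_of v) + num_of (tl_of v))" and c = 1]
    show "ptime E J (\<lambda>x. Num (num_of (g x) + num_of (h x)))" by simp
  qed (simp add: foldr_Num_add del: num_of.simps)
  then show ?thesis
    by (rule ptime_cong[rotated])
      (simp add: foldr_Num_add sum_list_distinct_conv_sum_set atLeast0LessThan del: num_of.simps)
qed

lemma foldr_Num_max:
  "foldr (\<lambda>i v. Num (max (num_of (Num (f i))) (num_of v))) is (Num a) = Num (Max (insert a (f ` set is)))"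
proof (induction "is")
  case (Cons i "is")
  have "Max (insert a (f ` set (i # is))) = max (f i) (Max (insert a (f ` set is)))"
    by (simp add: insert_commute[of a] del: Max_insert) (simp add: Max_insert[of "insert a _"])
  with Cons show ?case by simp
qed simp

lemma ptime_Max:
  fixes f :: "'a \<Rightarrow> nat \<Rightarrow> real"
  assumes n: "ptime D In (\<lambda>x. Num (real (n x)))" "polybdd D In n"
    and f: "ptime (SIGMA x:D. {..<n x}) (indexed In) (\<lambda>p. Num (f (fst p) (snd p)))"
  shows "ptime D In (\<lambda>x. Num (Max (insert 0 (f x ` {..<n x}))))"
proof -
  have "ptime D In (\<lambda>x. foldr (\<lambda>i v. Num (max (num_of (Num (f x i))) (num_of v))) [0..<n x] (Num 0))"
  proof (rule ptime_fold_index[OF n ptime_0 f _ polybdd_const[of _ _ 1]])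
    fix E :: "('a \<times> nat \<times> val) set" and J g h assume gh: "ptime E J g" "ptime E J h"
    have Num: "ptime E J (\<lambda>x. Num (num_of (f x)))" if "ptime E J f" for f
      using ptime_expr[OF that, where e = "\<lambda>k. Add (Var k) (Lit 0)"
          and h = "\<lambda>v. Num (num_of v)" and c = 1] by simp
    show "ptime E J (\<lambda>x. Num (max (num_of (g x)) (num_of (h x))))"
      by (intro ptime_max Num gh)
  qed (simp add: foldr_Num_max del: num_of.simps)
  then show ?thesis
    by (rule ptime_cong[rotated]) (simp add: foldr_Num_max atLeast0LessThan del: num_of.simps)
qed

lemma foldr_tl: "foldr (\<lambda>_. tl_of) is (enc_list vs) = enc_list (drop (length is) vs)"
  by (induction "is") (auto simp: drop_Suc tl_drop)

text \<open>
  The list is dropped step by step by a loop. The bound on the index also bounds the running time: an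
  arbitrary real atom could be exponentially large in the size of the input.
\<close>

lemma ptime_nth:
  fixes vs :: "'a \<Rightarrow> val list"
  assumes vs: "ptime D In (\<lambda>x. enc_list (vs x))" and j: "ptime D In (\<lambda>x. Num (real (j x)))"
    and less: "\<And>x. x \<in> D \<Longrightarrow> j x < length (vs x)"
  shows "ptime D In (\<lambda>x. vs x ! j x)"
proof -
  have bdd: "polybdd D In j"
    by (rule polybdd_mono[OF polybdd_length[OF vs]]) (use less in force)
  have "val_size (enc_list (drop i us)) \<le> val_size (enc_list us)" for i us
  proof (induction us arbitrary: i)
    case (Cons u us)
    then show ?case by (cases i) (auto intro: trans_le_add2 le_SucI)
  qed simp
  then have "ptime D In (\<lambda>x. foldr (\<lambda>i. (\<lambda>_. tl_of) Leaf) [0..<j x] (enc_list (vs x)))"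
    by (intro ptime_fold_index[OF j bdd vs ptime_Leaf _ ptime_sizeD[OF vs]] ptime_tl)
      (auto simp: foldr_tl)
  then have "ptime D In (\<lambda>x. hd_of (enc_list (drop (j x) (vs x))))"
    by (intro ptime_hd) (simp add: foldr_tl)
  then show ?thesis
    by (rule ptime_cong[rotated]) (metis Cons_nth_drop_Suc hd_tl_enc_list(1) less)
qed

text \<open>
  What is computable from the input of a loop is computable in its body.
\<close>

lemma ptime_fst: "ptime D In f \<Longrightarrow> ptime (SIGMA x:D. {..<n x}) (indexed In) (\<lambda>p. f (fst p))"
proof (erule ptime_compose)
  show "ptime (SIGMA x:D. {..<n x}) (indexed In) (\<lambda>p. In (fst p))"
    using ptime_tl[OF ptime_id, of "SIGMA x:D. {..<n x}" "indexed In"] by simp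
qed auto

lemma ptime_snd: "ptime D (indexed In) (\<lambda>p. Num (real (snd p)))"
  using ptime_hd[OF ptime_id, of D "indexed In"] by simp

lemma ptime_component:
  assumes "ptime D In (\<lambda>x. enc_list (vs x))" "\<And>x. x \<in> D \<Longrightarrow> k < length (vs x)"
  shows "ptime D In (\<lambda>x. vs x ! k)"
  using ptime_nth[OF assms(1), of "\<lambda>_. k"] ptime_int[of D In "int k"] assms(2) by simp

lemma ptime_vec_nth:
  assumes "ptime D In (\<lambda>x. enc_vec (n x) (f x))" "ptime D In (\<lambda>x. Num (real (j x)))"
    and "\<And>x. x \<in> D \<Longrightarrow> j x < n x"
  shows "ptime D In (\<lambda>x. Num (f x (j x)))"
  by (rule ptime_cong[OF _ ptime_nth[OF assms(1)[unfolded enc_vec_def] assms(2)]])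
    (auto dest: assms(3))

lemma ptime_vec_length:
  assumes "ptime D In (\<lambda>x. enc_vec (n x) (f x))"
  shows "ptime D In (\<lambda>x. Num (real (n x)))" "polybdd D In n"
  using ptime_length[OF assms[unfolded enc_vec_def]] polybdd_length[OF assms[unfolded enc_vec_def]]
  by simp_all

lemma ptime_map:
  assumes n: "ptime D In (\<lambda>x. Num (real (n x)))" "polybdd D In n"
    and F: "ptime (SIGMA x:D. {..<n x}) (indexed In) (\<lambda>p. F (fst p) (snd p))"
  shows "ptime D In (\<lambda>x. enc_list (map (F x) [0..<n x]))"
  using ptime_tabulate[OF n F, of "\<lambda>_. []"] by (simp add: ptime_Leaf)

lemma ptime_vec:
  assumes n: "ptime D In (\<lambda>x. Num (real (n x)))" "polybdd D In n"
    and "ptime (SIGMA x:D. {..<n x}) (indexed In) (\<lambda>p. Num (f (fst p) (snd p)))"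
  shows "ptime D In (\<lambda>x. enc_vec (n x) (f x))"
  using ptime_map[OF assms] by (simp add: enc_vec_def)

lemma ptime_mat:
  assumes m: "ptime D In (\<lambda>x. Num (real (m x)))" "polybdd D In m"
    and "ptime (SIGMA x:D. {..<m x}) (indexed In) (\<lambda>p. enc_vec (n (fst p)) (f (fst p) (snd p)))"
  shows "ptime D In (\<lambda>x. enc_mat (m x) (n x) (f x))"
  using ptime_map[OF m, of "\<lambda>x i. enc_vec (n x) (f x i)"] assms(3) by (simp add: enc_mat_def)

section \<open>Upper quantiles and conditional value at risk\<close>

text \<open>
  For \<open>f \<ge> 0\<close> and \<open>b \<le> m\<close> this is the largest value \<open>v\<close> of \<open>f\<close> such that at least \<open>b\<close> indices have
  values \<open>\<ge> v\<close>, that is, the \<open>\<lceil>b\<rceil>\<close>-th largest value for \<open>b > 0\<close>. Disqualified indices contribute \<open>0\<close>, so that one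
  maximum over all indices suffices, and comparing with the real number \<open>b\<close> avoids rounding,
  which the programs cannot do in one step.
\<close>

definition upper_quantile :: "nat \<Rightarrow> (nat \<Rightarrow> real) \<Rightarrow> real \<Rightarrow> real" where
  "upper_quantile m f b = Max (insert 0
     ((\<lambda>i. of_bool (b \<le> (\<Sum>j<m. of_bool (f i \<le> f j))) * f i) ` {..<m}))"

lemma sum_of_bool_card: "(\<Sum>j<(m :: nat). of_bool (P j) :: real) = real (card {j. j < m \<and> P j})"
  by (simp add: Int_def)

lemma upper_quantile_nonneg: "0 \<le> upper_quantile m f b"
  by (simp add: upper_quantile_def)

text \<open>
  The two faces of the quantile \<open>q\<close>: at least \<open>b\<close> values are \<open>\<ge> q\<close>, and (\<open>ex_le_upper_quantile\<close>)
  any \<open>b\<close> indices include one with value \<open>\<le> q\<close>.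
\<close>

lemma card_upper_quantile_le:
  assumes "b \<le> real m" and "\<And>i. i < m \<Longrightarrow> 0 \<le> f i"
  shows "b \<le> real (card {j. j < m \<and> upper_quantile m f b \<le> f j})"
proof -
  have "upper_quantile m f b \<in> insert 0
     ((\<lambda>i. of_bool (b \<le> (\<Sum>j<m. of_bool (f i \<le> f j))) * f i) ` {..<m})"
    unfolding upper_quantile_def by (rule Max_in) auto
  then consider "upper_quantile m f b = 0"
    | i where "i < m" "b \<le> (\<Sum>j<m. of_bool (f i \<le> f j))" "upper_quantile m f b = f i"
    by fastforce
  then show ?thesis
  proof cases
    case 1
    then have "{j. j < m \<and> upper_quantile m f b \<le> f j} = {..<m}" using assms(2) by auto
    then show ?thesis using assms(1) by simp
  next
    case 2
    then show ?thesis by (simp add: sum_of_bool_card)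
  qed
qed

lemma upper_quantile_ge:
  assumes "i < m" "b \<le> real (card {j. j < m \<and> f i \<le> f j})"
  shows "f i \<le> upper_quantile m f b"
  unfolding upper_quantile_def
proof (rule Max_ge)
  show "f i \<in> insert 0 ((\<lambda>i. of_bool (b \<le> (\<Sum>j<m. of_bool (f i \<le> f j))) * f i) ` {..<m})"
    using assms by (intro insertI2 image_eqI[of _ _ i]) (auto simp: sum_of_bool_card)
qed simp

text \<open>
  The index \<open>i\<close> in \<open>Q\<close> with the smallest value qualifies for the maximum, since all of \<open>Q\<close> lies above it.
\<close>

lemma ex_le_upper_quantile:
  assumes "Q \<subseteq> {..<m}" "Q \<noteq> {}" "b \<le> real (card Q)"
  shows "\<exists>i\<in>Q. f i \<le> upper_quantile m f b"
proof -
  have fin: "finite Q" using assms(1) finite_subset by blast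
  define i where "i = arg_min_on f Q"
  have i: "i \<in> Q" "\<And>j. j \<in> Q \<Longrightarrow> f i \<le> f j"
    using arg_min_if_finite[OF fin assms(2), of f] unfolding i_def by (auto simp: not_less)
  have "card Q \<le> card {j. j < m \<and> f i \<le> f j}"
    using assms(1) i(2) by (intro card_mono) auto
  with assms(3) have "f i \<le> upper_quantile m f b"
    using i(1) assms(1) by (intro upper_quantile_ge) auto
  with i(1) show ?thesis by blast
qed

text \<open>
  The conditional value at risk as a minimum over \<open>x\<close> and \<open>u\<close>, attained at the quantile \<open>q\<close>. Let \<open>B\<close> be \<open>k\<close>
  indices with the largest values. On \<open>B\<close> the excess over \<open>q\<close> is exactly \<open>f - q\<close>, off \<open>B\<close> it vanishes, and
  summing \<open>f i - x \<le> u i\<close> over \<open>B\<close> gives the claim because \<open>card B = k\<close> cancels the factor \<open>1 / k\<close>.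
\<close>

lemma excess_sum_ge:
  assumes f: "\<And>i. i < m \<Longrightarrow> 0 \<le> f i" and k: "0 < k" "k \<le> m"
    and u: "\<And>i. i < m \<Longrightarrow> f i - x \<le> u i" "\<And>i. i < m \<Longrightarrow> 0 \<le> u i"
  shows "upper_quantile m f (real k) + 1 / real k * (\<Sum>i<m. max 0 (f i - upper_quantile m f (real k)))
    \<le> x + 1 / real k * (\<Sum>i<m. u i)"
proof -
  define q where "q = upper_quantile m f (real k)"
  let ?L = "{i. i < m \<and> q < f i}" and ?U = "{i. i < m \<and> q \<le> f i}"
  have "card ?L \<le> k"
  proof (rule ccontr)
    assume "\<not> card ?L \<le> k"
    moreover from this have "?L \<noteq> {}"
      by (metis card.empty zero_le)
    ultimately have "\<exists>i\<in>?L. f i \<le> q"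
      unfolding q_def by (intro ex_le_upper_quantile) auto
    then show False by auto
  qed
  moreover have "k \<le> card ?U"
    using card_upper_quantile_le[of "real k" m f] k f unfolding q_def by simp
  ultimately obtain B where B: "?L \<subseteq> B" "B \<subseteq> ?U" "card B = k"
    using exists_subset_between[of ?L k ?U] by fastforce
  have Bm: "B \<subseteq> {..<m}" using B by auto
  have "(\<Sum>i<m. max 0 (f i - q)) = (\<Sum>i\<in>B. max 0 (f i - q))"
    using B(1) Bm by (intro sum.mono_neutral_right) (auto simp: max_def)
  also have "\<dots> = (\<Sum>i\<in>B. (f i - x) + (x - q))"
    using B(2) by (intro sum.cong) (auto simp: max_def)
  also have "\<dots> = (\<Sum>i\<in>B. f i - x) + real k * (x - q)"
    by (simp only: sum.distrib sum_constant B(3))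
  also have "\<dots> \<le> (\<Sum>i\<in>B. u i) + real k * (x - q)"
    using Bm u by (intro add_right_mono sum_mono) auto
  also have "\<dots> \<le> (\<Sum>i<m. u i) + real k * (x - q)"
    using Bm u by (intro add_right_mono sum_mono2) auto
  finally have "1 / real k * (\<Sum>i<m. max 0 (f i - q))
      \<le> 1 / real k * ((\<Sum>i<m. u i) + real k * (x - q))"
    by (intro mult_left_mono) auto
  also have "\<dots> = 1 / real k * (\<Sum>i<m. u i) + (x - q)"
    using k(1) by (simp add: field_simps)
  finally show ?thesis
    unfolding q_def[symmetric] by linarith
qed

section \<open>The reduced exponential cone program\<close>

text \<open>
  Two problems with the same set of attained objective values have the same kind of outcome; \<open>h\<close> is
  needed to translate an optimal point.
\<close>

lemma correct_outcome_transfer: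
  assumes sound: "\<And>x. x \<in> F \<Longrightarrow> h x \<in> G \<and> g (h x) = f x"
    and exact: "\<And>y. y \<in> G \<Longrightarrow> \<exists>x\<in>F. f x = g y"
    and r: "correct_outcome F f r"
  shows "correct_outcome G g (map_outcome h r)"
proof (cases r)
  case Infeasible
  then show ?thesis using r exact by auto
next
  case Unbounded
  then show ?thesis using r sound by (auto; metis)
next
  case (Unattained v)
  then show ?thesis using r sound exact by (auto; metis)
next
  case (Optimal x)
  then show ?thesis using r sound exact by (auto; metis)
qed

definition gap :: "ssd \<Rightarrow> nat \<Rightarrow> real" where
  "gap I a = thresh I a - access I a"

text \<open>
  All points with at least this gap are selected. Ties may make these more than \<open>\<lceil>\<beta> |\<A>|\<rceil>\<close> points,
  which does no harm.
\<close>

definition cutoff :: "ssd \<Rightarrow> real" where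
  "cutoff I = upper_quantile (n_pts I) (gap I) (beta I * real (n_pts I))"

text \<open>
  The number \<open>\<lfloor>(1 - \<gamma>) |\<A>|\<rfloor>\<close>, obtained by counting because programs have no rounding operation; see
  lemma \<open>tail_size\<close>.
\<close>

definition tail_size :: "ssd \<Rightarrow> real" where
  "tail_size I = (\<Sum>i<n_pts I. of_bool (real i + 1 \<le> (1 - gamma I) * real (n_pts I)))"

definition access_quantile :: "ssd \<Rightarrow> real" where
  "access_quantile I = upper_quantile (n_pts I) (access I) (tail_size I)"

text \<open>
  The least left-hand side of the budget constraint. The summand \<open>1\<close> is the least value of
  \<open>\<Sum>\<^sub>r \<pi>\<^sub>r \<tau>\<^sub>r\<close>.
\<close>

definition min_cvar :: "ssd \<Rightarrow> real" where
  "min_cvar I = 1 + access_quantile I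
     + 1 / tail_size I * (\<Sum>a<n_pts I. max 0 (access I a - access_quantile I))"

text \<open>
  The variables are \<open>\<mu>\<^sub>r\<close>, \<open>\<nu>\<^sub>r\<close> and \<open>\<zeta>\<^sub>r\<close>, in three blocks of length \<open>n\<close>, where \<open>\<zeta>\<^sub>r\<close> bounds
  \<open>exp (- (\<mu>\<^sub>r - \<Lambda>\<^sub>r) g)\<close> from above for \<open>g = cutoff I\<close>. The first inequality contains no variable: it
  makes the program infeasible exactly when the budget is too small. The common tolerance is read off
  at point \<open>0\<close>.
\<close>

definition reduced_ecp :: "ssd \<Rightarrow> ecp" where
  "reduced_ecp I = (let n = n_regs I in
     \<lparr>ecp_obj = map (\<lambda>r. cost I r) [0..<n] @ map (\<lambda>r. - kappa I) [0..<n] @ map (\<lambda>r. 0) [0..<n],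
      ecp_eqs = [],
      ecp_ineqs = ([], budget I - min_cvar I)
        # (map (\<lambda>r. (2 * n + r, - weight I r)) [0..<n], tol I 0)
        # map (\<lambda>r. ([(r, 1)], - (rate I r + eps I))) [0..<n]
        @ map (\<lambda>r. ([(n + r, 1)], 0)) [0..<n],
      ecp_cones = map (\<lambda>r. (([(r, 1)], - rate I r), ([], 1), ([(n + r, 1)], 0))) [0..<n]
        @ map (\<lambda>r. (([(2 * n + r, 1)], 0), ([], 1), ([(r, - cutoff I)], rate I r * cutoff I))) [0..<n]\<rparr>)"

text \<open>
  Points that are not selected get \<open>\<zeta>\<^sub>a\<^sub>r = 0\<close>, which lies on the face \<open>y = 0\<close> of the exponential cone.
\<close>

definition lift_sol :: "ssd \<Rightarrow> real list \<Rightarrow> ssd_sol" where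
  "lift_sol I x = (let n = n_regs I in
     \<lparr>mu = (\<lambda>r. x ! r), nu = (\<lambda>r. x ! (n + r)), ell = (\<lambda>r. 0), tau = (\<lambda>r. 1),
      zeta = (\<lambda>a r. of_bool (cutoff I \<le> gap I a) * x ! (2 * n + r)),
      uu = (\<lambda>a r. - (x ! r - rate I r) * gap I a),
      sel = (\<lambda>a. of_bool (cutoff I \<le> gap I a)),
      resp = (\<lambda>a. access I a + 1),
      excess = (\<lambda>a. max 0 (access I a - access_quantile I)),
      eta = 1 + access_quantile I\<rparr>)"

lemma affine_val_simps [simp]:
  "affine_val ([], b) x = b"
  "affine_val ([(j, a)], b) x = b + a * x ! j"
  "affine_val (map (\<lambda>r. (v r, w r)) [0..<n], b) x = b + (\<Sum>r<n. w r * x ! v r)"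
  by (simp_all add: affine_val_def o_def sum_list_distinct_conv_sum_set atLeast0LessThan)

lemma wf_reduced_ecp: "wf_ecp (reduced_ecp I)"
  by (auto simp: wf_ecp_def reduced_ecp_def wf_affine_def Let_def)

lemma K_exp_1 [simp]: "(x, 1, z) \<in> K_exp \<longleftrightarrow> exp z \<le> x"
  by (auto simp: K_exp_def)

lemma K_exp_0 [simp]: "(x, 0, z) \<in> K_exp \<longleftrightarrow> z \<le> 0 \<and> 0 \<le> x"
  by (auto simp: K_exp_def)

lemma length_ecp_obj [simp]: "length (ecp_obj (reduced_ecp I)) = 3 * n_regs I"
  by (simp add: reduced_ecp_def Let_def)

lemma reduced_feasible_iff:
  "x \<in> ecp_feasible (reduced_ecp I) \<longleftrightarrow> (let n = n_regs I in
     length x = 3 * n \<and> min_cvar I \<le> budget I \<and> (\<Sum>r<n. weight I r * x ! (2 * n + r)) \<le> tol I 0 \<and>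
     (\<forall>r<n. rate I r + eps I \<le> x ! r \<and> 0 \<le> x ! (n + r) \<and> exp (x ! (n + r)) \<le> x ! r - rate I r \<and>
        exp (- ((x ! r - rate I r) * cutoff I)) \<le> x ! (2 * n + r)))"
  unfolding ecp_feasible_def mem_Collect_eq length_ecp_obj
  by (auto simp: reduced_ecp_def Let_def ball_Un sum_negf algebra_simps)

lemma reduced_objective:
  "ecp_objective (reduced_ecp I) x =
     (\<Sum>r<n_regs I. cost I r * x ! r) - kappa I * (\<Sum>r<n_regs I. x ! (n_regs I + r))"
proof -
  have add: "(\<Sum>j<m + k. h j) = (\<Sum>j<m. h j) + (\<Sum>j<k. h (m + j))"
    for m k and h :: "nat \<Rightarrow> real"
    by (induction k) auto
  have 3: "3 * n = n + (n + n)" for n :: nat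
    by simp
  show ?thesis
    unfolding ecp_objective_def length_ecp_obj 3 add
    by (simp add: reduced_ecp_def Let_def nth_append sum_negf sum_distrib_left)
qed

lemma tail_size:
  assumes "valid_ssd I"
  obtains k where "0 < k" "k \<le> n_pts I" "tail_size I = real k"
    and "real_of_int \<lfloor>(1 - gamma I) * real (card (points I))\<rfloor> = real k"
proof -
  define y where "y = (1 - gamma I) * real (n_pts I)"
  have gamma: "0 \<le> gamma I" "gamma I < 1" and y1: "1 \<le> \<lfloor>y\<rfloor>"
    using assms by (auto simp: valid_ssd_def points_def y_def)
  have y: "y \<le> real (n_pts I)"
    using gamma unfolding y_def by (intro mult_left_le_one_le) auto
  define k where "k = nat \<lfloor>y\<rfloor>"
  have iff: "real i + 1 \<le> y \<longleftrightarrow> i < k" for i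
    unfolding k_def by linarith
  have k: "0 < k" "k \<le> n_pts I"
    using y1 y unfolding k_def by linarith+
  have "tail_size I = real (card {i. i < n_pts I \<and> i < k})"
    unfolding tail_size_def y_def[symmetric] iff by (rule sum_of_bool_card)
  also have "{i. i < n_pts I \<and> i < k} = {..<k}"
    using k by auto
  finally have "tail_size I = real k" by simp
  moreover have "real_of_int \<lfloor>(1 - gamma I) * real (card (points I))\<rfloor> = real k"
    using y1 unfolding k_def y_def points_def by simp
  ultimately show ?thesis
    using that k by blast
qed

lemma sum_weight: "valid_ssd I \<Longrightarrow> (\<Sum>r<n_regs I. weight I r) = 1"
  by (auto simp: weight_def valid_ssd_def regimes_def simp flip: sum_divide_distrib)

lemma weight_nonneg: "valid_ssd I \<Longrightarrow> r < n_regs I \<Longrightarrow> 0 \<le> weight I r"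
  by (auto simp: weight_def valid_ssd_def regimes_def)

lemma cutoff_card:
  assumes "valid_ssd I"
  shows "real_of_int \<lceil>beta I * real (n_pts I)\<rceil> \<le> real (card {a. a < n_pts I \<and> cutoff I \<le> gap I a})"
proof -
  have "beta I * real (n_pts I) \<le> real (n_pts I)"
    using assms by (intro mult_left_le_one_le) (auto simp: valid_ssd_def)
  then have "beta I * real (n_pts I) \<le> real (card {a. a < n_pts I \<and> cutoff I \<le> gap I a})"
    unfolding cutoff_def using assms
    by (intro card_upper_quantile_le) (auto simp: valid_ssd_def points_def gap_def)
  then have "\<lceil>beta I * real (n_pts I)\<rceil> \<le> int (card {a. a < n_pts I \<and> cutoff I \<le> gap I a})"
    by (simp add: ceiling_le_iff)
  then show ?thesis by linarith
qed

text \<open>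
  A selected point has a gap above the cutoff, so \<open>\<zeta>\<^sub>r \<ge> exp (- (\<mu>\<^sub>r - \<Lambda>\<^sub>r) cutoff)\<close> is large enough for
  it too (fact \<open>z\<close>).
\<close>

lemma lift_sol_feasible:
  assumes I: "valid_ssd I" "edges I = {}" "\<forall>a\<in>points I. tol I a = tol I 0"
    and x: "x \<in> ecp_feasible (reduced_ecp I)"
  shows "lift_sol I x \<in> ssd_feasible I"
proof -
  let ?n = "n_regs I" and ?m = "n_pts I"
  have budget: "min_cvar I \<le> budget I"
    and tol: "(\<Sum>r<?n. weight I r * x ! (2 * ?n + r)) \<le> tol I 0"
    using x unfolding reduced_feasible_iff Let_def by auto
  have reg: "rate I r + eps I \<le> x ! r" "0 \<le> x ! (?n + r)" "exp (x ! (?n + r)) \<le> x ! r - rate I r"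
      "exp (- ((x ! r - rate I r) * cutoff I)) \<le> x ! (2 * ?n + r)" if "r < ?n" for r
    using x that unfolding reduced_feasible_iff Let_def by auto
  obtain k where k: "0 < k" "k \<le> ?m" "tail_size I = real k"
    "real_of_int \<lfloor>(1 - gamma I) * real (card (points I))\<rfloor> = real k"
    using tail_size[OF I(1)] .
  have rate: "0 \<le> rate I r" if "r < ?n" for r
    using I(1) that by (auto simp: valid_ssd_def regimes_def)
  have eps: "0 < eps I" using I(1) by (simp add: valid_ssd_def)
  have gap: "0 \<le> gap I a" if "a < ?m" for a
    using I(1) that by (auto simp: valid_ssd_def points_def gap_def)
  have access: "0 \<le> access I a" if "a < ?m" for a
    using I(1) that by (auto simp: valid_ssd_def points_def)
  have q: "0 \<le> access_quantile I"
    by (simp add: access_quantile_def upper_quantile_nonneg)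
  have z: "exp (- ((x ! r - rate I r) * gap I a)) \<le> x ! (2 * ?n + r)"
    if "r < ?n" "cutoff I \<le> gap I a" for a r
  proof -
    have "(x ! r - rate I r) * cutoff I \<le> (x ! r - rate I r) * gap I a"
      using that reg(1)[OF that(1)] eps by (intro mult_left_mono) auto
    then show ?thesis
      by (intro order_trans[OF _ reg(4)[OF that(1)]]) simp
  qed
  have sel: "real_of_int \<lceil>beta I * real (card (points I))\<rceil>
      \<le> (\<Sum>a\<in>points I. of_bool (cutoff I \<le> gap I a))"
    using cutoff_card[OF I(1)] unfolding points_def sum_of_bool_card by simp
  have cvar: "1 + access_quantile I + 1 / real_of_int \<lfloor>(1 - gamma I) * real (card (points I))\<rfloor>
      * (\<Sum>a\<in>points I. max 0 (access I a - access_quantile I)) \<le> budget I"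
    using budget unfolding k(4) min_cvar_def k(3) by (simp add: points_def)
  have quality: "(\<Sum>r\<in>regimes I. weight I r * (of_bool (cutoff I \<le> gap I a) * x ! (2 * ?n + r)))
      \<le> 1 + (tol I a - 1) * of_bool (cutoff I \<le> gap I a)" if "a \<in> points I" for a
    using tol I(3) that by (auto simp: regimes_def)
  have cone: "(of_bool (cutoff I \<le> gap I a) * x ! (2 * ?n + r), of_bool (cutoff I \<le> gap I a),
      - (x ! r - rate I r) * gap I a) \<in> K_exp" if "a < ?m" "r < ?n" for a r
  proof (cases "cutoff I \<le> gap I a")
    case True
    then show ?thesis using z that(2) by (simp add: algebra_simps)
  next
    case False
    have "0 \<le> (x ! r - rate I r) * gap I a"
      using gap[OF that(1)] reg(1)[OF that(2)] eps by (intro mult_nonneg_nonneg) auto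
    with False show ?thesis by (simp add: algebra_simps)
  qed
  have eps_le: "eps I \<le> x ! r - rate I r" if "r < ?n" for r
    using reg(1)[OF that] by linarith
  have nonneg: "0 \<le> x ! r" if "r < ?n" for r
    using reg(1) rate eps that by fastforce
  show ?thesis
    unfolding ssd_feasible_def mem_Collect_eq lift_sol_def Let_def ssd_sol.simps
    using sel cvar quality cone eps_le reg(2-4) nonneg access q sum_weight[OF I(1)] I(2)
    by (auto simp: points_def regimes_def gap_def)
qed

lemma lift_sol_objective:
  "ssd_objective I (lift_sol I x) = ecp_objective (reduced_ecp I) x"
  by (simp add: ssd_objective_def reduced_objective lift_sol_def Let_def regimes_def)

text \<open>
  Any feasible solution selects at least \<open>\<beta> |\<A>|\<close> points, hence some \<open>b\<close> with gap at most the cutoff.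
  Its row \<open>\<zeta>\<^sub>b\<^sub>r\<close> satisfies the constraints on \<open>\<zeta>\<^sub>r\<close>; \<open>\<mu>\<close> and \<open>\<nu>\<close>, which determine the objective, are kept.
\<close>

lemma reduced_ecp_exact:
  assumes I: "valid_ssd I" "\<forall>a\<in>points I. tol I a = tol I 0"
    and X: "X \<in> ssd_feasible I"
  shows "\<exists>x\<in>ecp_feasible (reduced_ecp I). ecp_objective (reduced_ecp I) x = ssd_objective I X"
proof -
  let ?n = "n_regs I" and ?m = "n_pts I"
  have eps: "0 < eps I" and beta: "0 < beta I"
    using I(1) by (auto simp: valid_ssd_def)
  have mu: "rate I r + eps I \<le> mu X r" "0 \<le> nu X r" "exp (nu X r) \<le> mu X r - rate I r"
    and tau: "0 \<le> ell X r" "exp (ell X r) \<le> tau X r" if "r < ?n" for r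
    using X that unfolding ssd_feasible_def mem_Collect_eq regimes_def
    by (simp_all add: add.commute le_diff_eq)
  have qual: "(\<Sum>r<?n. weight I r * zeta X a r) \<le> 1 + (tol I a - 1) * sel X a"
    and cone: "r < ?n \<Longrightarrow> (zeta X a r, sel X a, - (mu X r - rate I r) * gap I a) \<in> K_exp"
    and sel: "sel X a \<in> {0, 1}"
    and resp: "access I a + (\<Sum>r<?n. weight I r * tau X r) \<le> resp X a"
    and excess: "resp X a - eta X \<le> excess X a" "0 \<le> excess X a" if "a < ?m" for a r
    using X that unfolding ssd_feasible_def mem_Collect_eq regimes_def points_def gap_def
    by (simp_all add: Ball_def) metis
  have sum_sel: "beta I * real ?m \<le> (\<Sum>a<?m. sel X a)"
    and cvar: "eta X + 1 / of_int \<lfloor>(1 - gamma I) * real (card (points I))\<rfloor> * (\<Sum>a<?m. excess X a)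
       \<le> budget I"
    using X order_trans[OF le_of_int_ceiling[of "beta I * real ?m"]]
    unfolding ssd_feasible_def mem_Collect_eq points_def by simp_all
  obtain k where k: "0 < k" "k \<le> ?m" "tail_size I = real k"
    "real_of_int \<lfloor>(1 - gamma I) * real (card (points I))\<rfloor> = real k"
    using tail_size[OF I(1)] .
  define Q where "Q = {a. a < ?m \<and> sel X a = 1}"
  have "(\<Sum>a<?m. sel X a) = (\<Sum>a<?m. of_bool (sel X a = 1))"
    using sel by (intro sum.cong) auto
  also have "\<dots> = real (card Q)"
    unfolding Q_def by (rule sum_of_bool_card)
  finally have card: "beta I * real ?m \<le> real (card Q)"
    using sum_sel by simp
  have "0 < beta I * real ?m"
    using beta k by simp
  with card have "Q \<noteq> {}"
    by auto
  then have "\<exists>b\<in>Q. gap I b \<le> cutoff I"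
    unfolding cutoff_def using card by (intro ex_le_upper_quantile) (auto simp: Q_def)
  then obtain b where b: "b < ?m" "sel X b = 1" "gap I b \<le> cutoff I"
    by (auto simp: Q_def)
  have "1 \<le> (\<Sum>r<?n. weight I r * tau X r)"
  proof -
    have "1 \<le> tau X r" if "r < ?n" for r
      using tau[OF that] by (meson one_le_exp_iff order_trans)
    then have "(\<Sum>r<?n. weight I r * 1) \<le> (\<Sum>r<?n. weight I r * tau X r)"
      using weight_nonneg[OF I(1)] by (intro sum_mono mult_left_mono) auto
    then show ?thesis
      by (simp add: sum_weight[OF I(1)])
  qed
  then have "access I a - (eta X - 1) \<le> excess X a" if "a < ?m" for a
    using resp[OF that] excess(1)[OF that] by linarith
  with excess(2) k I(1) have "access_quantile I + 1 / real k * (\<Sum>a<?m. max 0 (access I a - access_quantile I))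
      \<le> (eta X - 1) + 1 / real k * (\<Sum>a<?m. excess X a)"
    unfolding access_quantile_def k(3)
    by (intro excess_sum_ge) (auto simp: valid_ssd_def points_def)
  then have budget: "min_cvar I \<le> budget I"
    using cvar unfolding min_cvar_def k(3,4) by linarith
  define x where "x = map (mu X) [0..<?n] @ map (nu X) [0..<?n] @ map (zeta X b) [0..<?n]"
  have x: "length x = 3 * ?n" "r < ?n \<Longrightarrow> x ! r = mu X r" "r < ?n \<Longrightarrow> x ! (?n + r) = nu X r"
    "r < ?n \<Longrightarrow> x ! (2 * ?n + r) = zeta X b r" for r
    by (auto simp: x_def nth_append)
  have "exp (- ((mu X r - rate I r) * cutoff I)) \<le> zeta X b r" if "r < ?n" for r
  proof -
    have "(mu X r - rate I r) * gap I b \<le> (mu X r - rate I r) * cutoff I"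
      using b(3) mu(1)[OF that] eps by (intro mult_left_mono) auto
    then have "exp (- ((mu X r - rate I r) * cutoff I)) \<le> exp (- (mu X r - rate I r) * gap I b)"
      by (simp only: exp_le_cancel_iff mult_minus_left neg_le_iff_le)
    also have "\<dots> \<le> zeta X b r"
      using cone[OF b(1) that] b(2) by simp
    finally show ?thesis .
  qed
  moreover have "(\<Sum>r<?n. weight I r * zeta X b r) \<le> tol I 0"
    using qual[OF b(1)] I(2)[rule_format, of b] b(1,2) by (simp add: points_def)
  ultimately have "x \<in> ecp_feasible (reduced_ecp I)"
    unfolding reduced_feasible_iff Let_def using mu budget x by simp
  moreover have "ecp_objective (reduced_ecp I) x = ssd_objective I X"
    by (simp add: reduced_objective ssd_objective_def regimes_def x)
  ultimately show ?thesis by blast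
qed

lemma reduced_ecp_solves_ssd:
  assumes "valid_ssd I" "edges I = {}" "\<forall>a\<in>points I. tol I a = tol I 0"
    and "correct_outcome (ecp_feasible (reduced_ecp I)) (ecp_objective (reduced_ecp I)) r"
  shows "correct_outcome (ssd_feasible I) (ssd_objective I) (map_outcome (lift_sol I) r)"
  using lift_sol_feasible[OF assms(1-3)] reduced_ecp_exact[OF assms(1,3)] lift_sol_objective
  by (intro correct_outcome_transfer[OF _ _ assms(4)]) auto

section \<open>The reduction in polynomial time\<close>

text \<open>
  The double loop over all pairs of indices makes sorting unnecessary.
\<close>

lemma ptime_upper_quantile:
  assumes f: "ptime D In (\<lambda>x. enc_vec (m x) (f x))" and b: "ptime D In (\<lambda>x. Num (b x))"
  shows "ptime D In (\<lambda>x. Num (upper_quantile (m x) (f x) (b x)))"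
proof -
  let ?E = "SIGMA x:D. {..<m x}"
  let ?E' = "SIGMA p:?E. {..<m (fst p)}"
  note m = ptime_vec_length[OF f]
  have fi: "ptime ?E (indexed In) (\<lambda>p. Num (f (fst p) (snd p)))"
    by (rule ptime_vec_nth[OF ptime_fst[OF f] ptime_snd]) auto
  have fj: "ptime ?E' (indexed (indexed In)) (\<lambda>p. Num (f (fst (fst p)) (snd p)))"
    by (rule ptime_vec_nth[OF ptime_fst[OF ptime_fst[OF f]] ptime_snd]) auto
  have "ptime ?E (indexed In) (\<lambda>p. Num (\<Sum>j<m (fst p). of_bool (f (fst p) (snd p) \<le> f (fst p) j)))"
    by (intro ptime_sum ptime_vec_length[OF ptime_fst[OF f]] ptime_of_bool_le ptime_fst[OF fi] fj)
  then show ?thesis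
    unfolding upper_quantile_def
    by (intro ptime_Max m ptime_times ptime_of_bool_le ptime_fst[OF b] fi)
qed

lemma ptime_real_add:
  "ptime D In (\<lambda>x. Num (real (i x))) \<Longrightarrow> ptime D In (\<lambda>x. Num (real (j x))) \<Longrightarrow>
   ptime D In (\<lambda>x. Num (real (i x + j x)))"
  unfolding of_nat_add by (rule ptime_add)

lemma ptime_real_double:
  "ptime D In (\<lambda>x. Num (real (i x))) \<Longrightarrow> ptime D In (\<lambda>x. Num (real (2 * i x)))"
  unfolding mult_2 by (intro ptime_real_add)

lemma ptime_enc_affine_const:
  "ptime D In (\<lambda>x. Num (b x)) \<Longrightarrow> ptime D In (\<lambda>x. enc_affine ([], b x))"
  unfolding enc_affine_def by (simp add: ptime_Cell ptime_Leaf)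

lemma ptime_enc_affine_single:
  "ptime D In (\<lambda>x. Num (real (j x))) \<Longrightarrow> ptime D In (\<lambda>x. Num (a x)) \<Longrightarrow>
   ptime D In (\<lambda>x. Num (b x)) \<Longrightarrow> ptime D In (\<lambda>x. enc_affine ([(j x, a x)], b x))"
  unfolding enc_affine_def by (simp add: ptime_Cell ptime_Leaf)

lemma ssd_components:
  assumes "ptime D In (\<lambda>x. enc_ssd (I x))"
  shows ptime_rate: "ptime D In (\<lambda>x. enc_vec (n_regs (I x)) (rate (I x)))"
    and ptime_cost: "ptime D In (\<lambda>x. enc_vec (n_regs (I x)) (cost (I x)))"
    and ptime_kappa: "ptime D In (\<lambda>x. Num (kappa (I x)))"
    and ptime_eps: "ptime D In (\<lambda>x. Num (eps (I x)))"
    and ptime_access: "ptime D In (\<lambda>x. enc_vec (n_pts (I x)) (access (I x)))"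
    and ptime_thresh: "ptime D In (\<lambda>x. enc_vec (n_pts (I x)) (thresh (I x)))"
    and ptime_tol: "ptime D In (\<lambda>x. enc_vec (n_pts (I x)) (tol (I x)))"
    and ptime_beta: "ptime D In (\<lambda>x. Num (beta (I x)))"
    and ptime_gamma: "ptime D In (\<lambda>x. Num (gamma (I x)))"
    and ptime_budget: "ptime D In (\<lambda>x. Num (budget (I x)))"
proof -
  note I = ptime_component[OF assms[unfolded enc_ssd_def Let_def]]
  show "ptime D In (\<lambda>x. enc_vec (n_regs (I x)) (rate (I x)))" using I[of 0] by simp
  show "ptime D In (\<lambda>x. enc_vec (n_regs (I x)) (cost (I x)))" using I[of 1] by simp
  show "ptime D In (\<lambda>x. Num (kappa (I x)))" using I[of 2] by simp
  show "ptime D In (\<lambda>x. Num (eps (I x)))" using I[of 3] by simp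
  show "ptime D In (\<lambda>x. enc_vec (n_pts (I x)) (access (I x)))" using I[of 4] by simp
  show "ptime D In (\<lambda>x. enc_vec (n_pts (I x)) (thresh (I x)))" using I[of 5] by simp
  show "ptime D In (\<lambda>x. enc_vec (n_pts (I x)) (tol (I x)))" using I[of 6] by simp
  show "ptime D In (\<lambda>x. Num (beta (I x)))" using I[of 7] by simp
  show "ptime D In (\<lambda>x. Num (gamma (I x)))" using I[of 8] by simp
  show "ptime D In (\<lambda>x. Num (budget (I x)))" using I[of 9] by simp
qed

lemma ssd_sizes:
  assumes "ptime D In (\<lambda>x. enc_ssd (I x))"
  shows ptime_n_regs: "ptime D In (\<lambda>x. Num (real (n_regs (I x))))" "polybdd D In (\<lambda>x. n_regs (I x))"
    and ptime_n_pts: "ptime D In (\<lambda>x. Num (real (n_pts (I x))))" "polybdd D In (\<lambda>x. n_pts (I x))"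
  using ptime_vec_length[OF ptime_rate[OF assms]] ptime_vec_length[OF ptime_access[OF assms]] by auto

lemma ptime_weight:
  assumes I: "ptime D In (\<lambda>x. enc_ssd (I x))" and r: "ptime D In (\<lambda>x. Num (real (r x)))"
    and less: "\<And>x. x \<in> D \<Longrightarrow> r x < n_regs (I x)"
  shows "ptime D In (\<lambda>x. Num (weight (I x) (r x)))"
proof -
  have "ptime (SIGMA x:D. {..<n_regs (I x)}) (indexed In) (\<lambda>p. Num (rate (I (fst p)) (snd p)))"
    by (rule ptime_vec_nth[OF ptime_fst[OF ptime_rate[OF I]] ptime_snd]) auto
  then show ?thesis
    unfolding weight_def regimes_def
    by (intro ptime_divide ptime_vec_nth[OF ptime_rate[OF I] r less] ptime_sum ptime_n_regs[OF I])
qed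

lemma ptime_gap:
  assumes I: "ptime D In (\<lambda>x. enc_ssd (I x))"
  shows "ptime D In (\<lambda>x. enc_vec (n_pts (I x)) (gap (I x)))"
  unfolding gap_def
  by (intro ptime_vec ptime_n_pts[OF I] ptime_diff ptime_vec_nth[OF ptime_fst[OF ptime_thresh[OF I]] ptime_snd]
    ptime_vec_nth[OF ptime_fst[OF ptime_access[OF I]] ptime_snd]) auto

lemma ptime_cutoff:
  assumes I: "ptime D In (\<lambda>x. enc_ssd (I x))"
  shows "ptime D In (\<lambda>x. Num (cutoff (I x)))"
  unfolding cutoff_def
  by (intro ptime_upper_quantile ptime_gap[OF I] ptime_times ptime_beta[OF I] ptime_n_pts[OF I])

lemma ptime_tail_size:
  assumes I: "ptime D In (\<lambda>x. enc_ssd (I x))"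
  shows "ptime D In (\<lambda>x. Num (tail_size (I x)))"
  unfolding tail_size_def
  by (intro ptime_sum ptime_n_pts[OF I] ptime_of_bool_le ptime_add ptime_snd ptime_1 ptime_times
    ptime_diff ptime_gamma[OF ptime_fst[OF I]] ptime_n_pts[OF ptime_fst[OF I]])

lemma ptime_access_quantile:
  assumes I: "ptime D In (\<lambda>x. enc_ssd (I x))"
  shows "ptime D In (\<lambda>x. Num (access_quantile (I x)))"
  unfolding access_quantile_def
  by (intro ptime_upper_quantile ptime_access[OF I] ptime_tail_size[OF I])

lemma ptime_access_excess:
  assumes I: "ptime D In (\<lambda>x. enc_ssd (I x))"
  shows "ptime (SIGMA x:D. {..<n_pts (I x)}) (indexed In)
    (\<lambda>p. Num (max 0 (access (I (fst p)) (snd p) - access_quantile (I (fst p)))))"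
proof -
  have "ptime (SIGMA x:D. {..<n_pts (I x)}) (indexed In) (\<lambda>p. Num (access (I (fst p)) (snd p)))"
    by (rule ptime_vec_nth[OF ptime_fst[OF ptime_access[OF I]] ptime_snd]) auto
  then show ?thesis
    by (intro ptime_max ptime_0 ptime_diff ptime_access_quantile ptime_fst[OF I])
qed

lemma ptime_min_cvar:
  assumes I: "ptime D In (\<lambda>x. enc_ssd (I x))"
  shows "ptime D In (\<lambda>x. Num (min_cvar (I x)))"
  unfolding min_cvar_def
  by (intro ptime_add ptime_1 ptime_times ptime_divide ptime_access_quantile[OF I]
    ptime_tail_size[OF I] ptime_sum ptime_n_pts[OF I] ptime_access_excess[OF I])

text \<open>
  The encoded program written with tables of atoms and single-variable affine forms only, the shape
  to which the closure rules apply.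
\<close>

lemma enc_reduced_ecp:
  "enc_ecp (reduced_ecp I) = (let n = n_regs I in enc_list
     [enc_list (map (\<lambda>r. Num (cost I r)) [0..<n]
        @ map (\<lambda>r. Num (- kappa I)) [0..<n] @ map (\<lambda>r. Num 0) [0..<n]),
      Leaf,
      Cell (enc_affine ([], budget I - min_cvar I))
        (Cell (Cell (enc_list (map (\<lambda>r. Cell (Num (real (2 * n + r))) (Num (- weight I r))) [0..<n]))
            (Num (tol I 0)))
          (enc_list (map (\<lambda>r. enc_affine ([(r, 1)], - (rate I r + eps I))) [0..<n]
            @ map (\<lambda>r. enc_affine ([(n + r, 1)], 0)) [0..<n]))),
      enc_list (map (\<lambda>r. enc_list [enc_affine ([(r, 1)], - rate I r), enc_affine ([], 1),
            enc_affine ([(n + r, 1)], 0)]) [0..<n]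
        @ map (\<lambda>r. enc_list [enc_affine ([(2 * n + r, 1)], 0), enc_affine ([], 1),
            enc_affine ([(r, - cutoff I)], rate I r * cutoff I)]) [0..<n])])"
  by (simp add: enc_ecp_def reduced_ecp_def Let_def enc_reals_def o_def enc_affine_def[of "(map _ _, _)"])

lemma ptime_reduced_ecp:
  assumes pts: "\<And>I. I \<in> Is \<Longrightarrow> 0 < n_pts I"
  shows "ptime Is enc_ssd (\<lambda>I. enc_ecp (reduced_ecp I))"
proof -
  let ?E = "SIGMA I:Is. {..<n_regs I}"
  have I: "ptime Is enc_ssd (\<lambda>I. enc_ssd I)" by (rule ptime_id)
  have I': "ptime ?E (indexed enc_ssd) (\<lambda>p. enc_ssd (fst p))" by (rule ptime_fst[OF I])
  have rate: "ptime ?E (indexed enc_ssd) (\<lambda>p. Num (rate (fst p) (snd p)))"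
    by (rule ptime_vec_nth[OF ptime_rate[OF I'] ptime_snd]) auto
  have cost: "ptime ?E (indexed enc_ssd) (\<lambda>p. Num (cost (fst p) (snd p)))"
    by (rule ptime_vec_nth[OF ptime_cost[OF I'] ptime_snd]) auto
  have weight: "ptime ?E (indexed enc_ssd) (\<lambda>p. Num (weight (fst p) (snd p)))"
    by (rule ptime_weight[OF I' ptime_snd]) auto
  have tol: "ptime Is enc_ssd (\<lambda>I. Num (tol I 0))"
    by (rule ptime_vec_nth[OF ptime_tol[OF I]]) (auto simp: ptime_0 pts)
  show ?thesis
    unfolding enc_reduced_ecp Let_def enc_list.simps
    by (intro ptime_Cell ptime_Leaf ptime_tabulate ptime_map ptime_n_regs[OF I] cost ptime_uminus
        ptime_kappa[OF I'] ptime_0 ptime_1 ptime_enc_affine_const ptime_enc_affine_single ptime_diff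
        ptime_budget[OF I] ptime_min_cvar[OF I] ptime_real_add ptime_real_double ptime_n_regs[OF I']
        ptime_snd weight tol rate ptime_add ptime_eps[OF I'] ptime_times ptime_cutoff[OF I'])
qed

lemma ptime_lift_sol:
  "ptime {(I, x). length x = 3 * n_regs I} (\<lambda>y. Cell (enc_reals (snd y)) (enc_ssd (fst y)))
     (\<lambda>y. enc_ssd_sol (fst y) (lift_sol (fst y) (snd y)))"
proof -
  let ?D = "{(I, x :: real list). length x = 3 * n_regs I}"
  let ?In = "\<lambda>y :: ssd \<times> real list. Cell (enc_reals (snd y)) (enc_ssd (fst y))"
  have I: "ptime ?D ?In (\<lambda>y. enc_ssd (fst y))"
    using ptime_tl[OF ptime_id, of ?D ?In] by simp
  have x: "ptime ?D ?In (\<lambda>y. enc_list (map Num (snd y)))"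
    using ptime_hd[OF ptime_id, of ?D ?In] by (simp add: enc_reals_def)
  let ?R = "SIGMA y:?D. {..<n_regs (fst y)}"
  let ?P = "SIGMA y:?D. {..<n_pts (fst y)}"
  let ?PR = "SIGMA p:?P. {..<n_regs (fst (fst p))}"
  have nth: "ptime E J (\<lambda>e. Num (z e ! j e))"
    if "ptime E J (\<lambda>e. enc_list (map Num (z e)))" "ptime E J (\<lambda>e. Num (real (j e)))"
      "\<And>e. e \<in> E \<Longrightarrow> j e < length (z e)" for E and J :: "'e \<Rightarrow> val" and z j
    by (rule ptime_cong[OF _ ptime_nth[OF that(1,2)]]) (auto dest: that(3))
  have mu: "ptime ?R (indexed ?In) (\<lambda>p. Num (snd (fst p) ! snd p))"
    by (rule nth[OF ptime_fst[OF x] ptime_snd]) auto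
  have nu: "ptime ?R (indexed ?In) (\<lambda>p. Num (snd (fst p) ! (n_regs (fst (fst p)) + snd p)))"
    by (rule nth[OF ptime_fst[OF x]])
      (intro ptime_real_add ptime_n_regs ptime_fst[OF I] ptime_snd, auto)
  have IP: "ptime ?P (indexed ?In) (\<lambda>p. enc_ssd (fst (fst p)))"
    by (rule ptime_fst[OF I])
  have IPR: "ptime ?PR (indexed (indexed ?In)) (\<lambda>p. enc_ssd (fst (fst (fst p))))"
    by (rule ptime_fst[OF IP])
  have xPR: "ptime ?PR (indexed (indexed ?In)) (\<lambda>p. enc_list (map Num (snd (fst (fst p)))))"
    by (rule ptime_fst[OF ptime_fst[OF x]])
  have z: "ptime ?PR (indexed (indexed ?In))
      (\<lambda>p. Num (snd (fst (fst p)) ! (2 * n_regs (fst (fst (fst p))) + snd p)))"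
    by (rule nth[OF xPR]) (intro ptime_real_add ptime_real_double ptime_n_regs IPR ptime_snd, auto)
  have muP: "ptime ?PR (indexed (indexed ?In)) (\<lambda>p. Num (snd (fst (fst p)) ! snd p))"
    by (rule nth[OF xPR ptime_snd]) auto
  have rate: "ptime ?PR (indexed (indexed ?In)) (\<lambda>p. Num (rate (fst (fst (fst p))) (snd p)))"
    by (rule ptime_vec_nth[OF ptime_rate[OF IPR] ptime_snd]) auto
  have gap: "ptime ?P (indexed ?In) (\<lambda>p. Num (gap (fst (fst p)) (snd p)))"
    by (rule ptime_vec_nth[OF ptime_gap[OF IP] ptime_snd]) auto
  have access: "ptime ?P (indexed ?In) (\<lambda>p. Num (access (fst (fst p)) (snd p)))"
    by (rule ptime_vec_nth[OF ptime_access[OF IP] ptime_snd]) auto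
  have sel: "ptime ?P (indexed ?In)
      (\<lambda>p. Num (of_bool (cutoff (fst (fst p)) \<le> gap (fst (fst p)) (snd p))))"
    by (intro ptime_of_bool_le ptime_cutoff IP gap)
  show ?thesis
    unfolding enc_ssd_sol_def lift_sol_def Let_def ssd_sol.simps enc_list.simps
    by (intro ptime_Cell ptime_Leaf ptime_vec ptime_mat ptime_n_regs[OF I] ptime_n_pts[OF I]
        ptime_n_regs[OF IP] mu nu ptime_0 ptime_1 ptime_times ptime_fst[OF sel] sel z
        ptime_uminus ptime_diff muP rate ptime_fst[OF gap] ptime_add access
        ptime_access_excess[OF I] ptime_access_quantile[OF I])
qed

definition outcome_code :: "'x outcome \<Rightarrow> real" where
  "outcome_code r = (case r of Infeasible \<Rightarrow> 0 | Unbounded \<Rightarrow> 1 | Unattained v \<Rightarrow> 2 | Optimal x \<Rightarrow> 3)"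

lemma hd_enc_outcome: "hd_of (enc_outcome enc r) = Num (outcome_code r)"
  by (cases r) (auto simp: outcome_code_def)

text \<open>
  Unspecified unless the outcome is optimal, the only case in which it is used.
\<close>

definition optimum :: "'x outcome \<Rightarrow> 'x" where
  "optimum r = (THE x. r = Optimal x)"

lemma optimum_Optimal [simp]: "optimum (Optimal x) = x"
  by (simp add: optimum_def)

text \<open>
  The precondition under which the second half of the program runs: an instance together with a
  correct outcome for its reduced program, as supplied by the solver.
\<close>

definition reduced_outcomes :: "(ssd \<times> real list outcome) set" where
  "reduced_outcomes = {(I, r). correct_outcome (ecp_feasible (reduced_ecp I)) (ecp_objective (reduced_ecp I)) r}"

text \<open>
  An outcome without a solution is passed on unchanged, since its encoding does not depend on the
  type of solutions.
\<close>

lemma ptime_lift_outcome: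
  "ptime reduced_outcomes (\<lambda>y. Cell (enc_outcome enc_reals (snd y)) (enc_ssd (fst y)))
     (\<lambda>y. enc_outcome (enc_ssd_sol (fst y)) (map_outcome (lift_sol (fst y)) (snd y)))"
proof -
  let ?In = "\<lambda>y :: ssd \<times> real list outcome. Cell (enc_outcome enc_reals (snd y)) (enc_ssd (fst y))"
  let ?Opt = "{y \<in> reduced_outcomes. \<not> outcome_code (snd y) \<le> 2}"
  have r: "ptime D ?In (\<lambda>y. enc_outcome enc_reals (snd y))" for D
    using ptime_hd[OF ptime_id, of D ?In] by simp
  have I: "ptime D ?In (\<lambda>y. enc_ssd (fst y))" for D
    using ptime_tl[OF ptime_id, of D ?In] by simp
  have code: "ptime reduced_outcomes ?In (\<lambda>y. Num (outcome_code (snd y)))"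
    using ptime_hd[OF r] by (simp add: hd_enc_outcome)
  have Opt: "\<exists>x. snd y = Optimal x \<and> length x = 3 * n_regs (fst y)" if "y \<in> ?Opt" for y
    using that by (cases "snd y")
      (auto simp: reduced_outcomes_def outcome_code_def reduced_feasible_iff Let_def)
  have "ptime ?Opt ?In (\<lambda>y. hd_of (tl_of (enc_outcome enc_reals (snd y))))"
    by (intro ptime_hd ptime_tl r)
  then have "ptime ?Opt ?In (\<lambda>y. enc_reals (optimum (snd y)))"
    by (rule ptime_cong[rotated]) (use Opt in force)
  from ptime_Cell[OF this I]
  have "ptime ?Opt ?In (\<lambda>y. Cell (enc_reals (snd (fst y, optimum (snd y))))
      (enc_ssd (fst (fst y, optimum (snd y)))))"
    by simp
  from ptime_compose[OF ptime_lift_sol this]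
  have sol: "ptime ?Opt ?In (\<lambda>y. enc_ssd_sol (fst y) (lift_sol (fst y) (optimum (snd y))))"
    using Opt by fastforce
  have "ptime reduced_outcomes ?In (\<lambda>y. if outcome_code (snd y) \<le> 2 then enc_outcome enc_reals (snd y)
      else Cell (Num 3) (Cell (enc_ssd_sol (fst y) (lift_sol (fst y) (optimum (snd y)))) Leaf))"
    by (intro ptime_If code ptime_numeral r ptime_Cell sol ptime_Leaf)
  then show ?thesis
  proof (rule ptime_cong[rotated])
    fix y assume "y \<in> reduced_outcomes"
    show "enc_outcome (enc_ssd_sol (fst y)) (map_outcome (lift_sol (fst y)) (snd y)) =
      (if outcome_code (snd y) \<le> 2 then enc_outcome enc_reals (snd y)
       else Cell (Num 3) (Cell (enc_ssd_sol (fst y) (lift_sol (fst y) (optimum (snd y)))) Leaf))"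
      by (cases "snd y") (auto simp: outcome_code_def)
  qed
qed

text \<open>
  The solver's answer is the input of the second half of the program, so its size must be bounded in
  terms of the instance.
\<close>

lemma val_size_enc_outcome:
  assumes "(I, r) \<in> reduced_outcomes"
  shows "val_size (enc_outcome enc_reals r) \<le> 6 * n_regs I + 6"
  using assms by (cases r)
    (auto simp: reduced_outcomes_def reduced_feasible_iff Let_def enc_reals_def val_size_enc_list o_def sum_list_triv)

theorem theorem3:
  "polytime_solvable enc_ssd ssd_answers
     {I. valid_ssd I \<and> edges I = {} \<and> (\<exists>\<alpha>. \<forall>a\<in>points I. tol I a = \<alpha>)}"
proof -
  let ?Is = "{I. valid_ssd I \<and> edges I = {} \<and> (\<exists>\<alpha>. \<forall>a\<in>points I. tol I a = \<alpha>)}"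
  have pts: "0 < n_pts I" if "I \<in> ?Is" for I
    using that tail_size[of I] by fastforce
  have tol: "\<forall>a\<in>points I. tol I a = tol I 0" if "I \<in> ?Is" for I
    using that pts[OF that] by (auto simp: points_def)
  have pre: "ptime ?Is enc_ssd (\<lambda>I. enc_ecp (reduced_ecp I))"
    by (rule ptime_reduced_ecp) (rule pts)
  obtain C1 b1 where b1: "polybdd ?Is enc_ssd b1"
    and C1: "computes C1 b1 ?Is enc_ssd (\<lambda>I. Cell (enc_ecp (reduced_ecp I)) (enc_ssd I))"
    using ptime_Cell[OF pre ptime_id] by (rule ptimeE)
  obtain C2 b2 where b2: "polybdd reduced_outcomes (\<lambda>y. Cell (enc_outcome enc_reals (snd y)) (enc_ssd (fst y))) b2"
    and C2: "computes C2 b2 reduced_outcomes (\<lambda>y. Cell (enc_outcome enc_reals (snd y)) (enc_ssd (fst y)))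
       (\<lambda>y. enc_outcome (enc_ssd_sol (fst y)) (map_outcome (lift_sol (fst y)) (snd y)))"
    using ptime_lift_outcome by (rule ptimeE)
  \<comment> \<open>The instance is kept next to the reduced program, as it is needed again to lift the answer.\<close>
  define prog where "prog = Seq (C1 0) (Seq (Solve 1 (Hd (Var 0)))
      (Seq (Assign 0 (Pair (Var 1) (Tl (Var 0)))) (C2 0)))"
  show ?thesis
    unfolding polytime_solvable_def
  proof (rule exI[of _ prog], intro allI impI)
    fix S T assume solver: "ecp_solver S T"
    have "\<exists>r. (I, r) \<in> reduced_outcomes \<and> S (enc_ecp (reduced_ecp I)) = enc_outcome enc_reals r" for I
      using solver wf_reduced_ecp[of I]
      unfolding ecp_solver_def ecp_answers_def reduced_outcomes_def by fastforce
    then obtain r where r: "\<And>I. (I, r I) \<in> reduced_outcomes"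
      "\<And>I. S (enc_ecp (reduced_ecp I)) = enc_outcome enc_reals (r I)"
      by metis
    obtain q where q: "\<And>P. wf_ecp P \<Longrightarrow> T (enc_ecp P) \<le> poly q (val_size (enc_ecp P))"
      using solver unfolding ecp_solver_def by blast
    have T: "polybdd ?Is enc_ssd (\<lambda>I. T (enc_ecp (reduced_ecp I)))"
      by (rule polybdd_mono[OF polybdd_poly[OF ptime_sizeD[OF pre], of q]])
        (rule q[OF wf_reduced_ecp])
    have "polybdd ?Is enc_ssd (\<lambda>I. 1 + (6 * n_regs I + 6) + val_size (enc_ssd I))"
      by (intro polybdd_intros ptime_n_regs[OF ptime_id])
    then have "polybdd ?Is enc_ssd
        (\<lambda>I. val_size (Cell (enc_outcome enc_reals (snd (I, r I))) (enc_ssd (fst (I, r I)))))"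
      by (rule polybdd_mono) (use val_size_enc_outcome[OF r(1)] in \<open>simp add: add.commute\<close>)
    from polybdd_reindex[OF b2 _ this] r(1)
    have b2': "polybdd ?Is enc_ssd (\<lambda>I. b2 (I, r I))" by blast
    let ?b = "\<lambda>I. b1 I + ((1 + T (enc_ecp (reduced_ecp I))) + (1 + b2 (I, r I)))"
    have "polybdd ?Is enc_ssd ?b"
      by (intro polybdd_intros b1 T b2')
    then obtain p where p: "\<And>I. I \<in> ?Is \<Longrightarrow> ?b I \<le> poly p (val_size (enc_ssd I))"
      unfolding polybdd_def by blast
    have run: "ends_within S T prog ((\<lambda>_. Leaf)(0 := enc_ssd I)) (?b I)
        (\<lambda>s'. s' 0 \<in> ssd_answers I)" if I: "I \<in> ?Is" for I
    proof -
      have "correct_outcome (ssd_feasible I) (ssd_objective I) (map_outcome (lift_sol I) (r I))"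
        using I r(1)[of I] by (intro reduced_ecp_solves_ssd tol) (auto simp: reduced_outcomes_def)
      then have answer: "enc_outcome (enc_ssd_sol I) (map_outcome (lift_sol I) (r I)) \<in> ssd_answers I"
        by (auto simp: ssd_answers_def)
      have solve: "ends_within S T (Solve 1 (Hd (Var 0))) s (1 + T (enc_ecp (reduced_ecp I))) Q"
        if "s 0 = Cell (enc_ecp (reduced_ecp I)) (enc_ssd I)"
          "Q (s(1 := enc_outcome enc_reals (r I)))" for s Q
        using ends_within_Solve[of Q s 1 S "Hd (Var 0)" T] that r(2) by simp
      show ?thesis
        unfolding prog_def using I r(1) answer
        by (intro ends_within_Seq computesD[OF C1, where x = I] solve computesD[OF C2, where x = "(I, r I)"]
            ends_within_Assign) auto
    qed
    show "\<exists>q. \<forall>I\<in>?Is. \<exists>t s'. exec S T prog ((\<lambda>_. Leaf)(0 := enc_ssd I)) t s' \<and>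
        t \<le> poly q (val_size (enc_ssd I)) \<and> s' 0 \<in> ssd_answers I"
      using run p unfolding ends_within_def by (meson order_trans)
  qed
qed

end
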